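(* Let $U=B(0,1)$ be the unit ball in $\mathbb{R}^d$, $d\ge2$, and let $(m_k),(\alpha_k),(\beta_k)$, $X_k$, $r_k$, $k_2$, $\varphi$ and $f$ be as described in the context. Let $\delta>0$. Then there exists $k'\ge k_2$ such that the union $A$ of all $\overline B(x,r_x)$, $x\in X_k$, $k\ge k'$, is unavoidable, $U\setminus A$ is a champagne subregion of $U$, and $$\sum_{x\in X_A}\varphi(r_x)\,f(\varphi(r_x))<\delta,$$ where $X_A=\bigcup_{k\ge k'}X_k$.
   Context: $B(x,r)$ and $\overline B(x,r)$ denote open and closed Euclidean balls. Let $\varphi(t):=(\log\frac1t)^{-1}$ (for $t\in(0,1)$) if $d=2$, and $\varphi(t):=t^{d-2}$ if $d\ge3$. Setting: Let $k_0\in\mathbb{N}$ and, for $k\ge k_0$, let $m_k\in\mathbb{N}$ (positive integers), $\alpha_k,\beta_k\in(0,\infty)$ with $m_k\le m_{k+1}$, $\alpha_{k+1}\le\alpha_k$, $\beta_k\le\beta_{k+1}$, and $$\alpha_k\le 1/\max\{k,m_k\},\quad 1\le\beta_k\le k,\quad \sum_{k\ge k_0}m_k\alpha_k=\infty,\quad \sum_{k\ge k_0}m_k\alpha_k/\beta_k<1/2.$$ For $k\ge k_0$ let $a_k:=\alpha_k/\beta_k$, $R_k:=1-\sum_{j=k}^\infty m_ja_j>\frac12$, and $U_k:=B(0,R_k)$. For every $k\ge k_0$ fix a finite set $X_k\subset\partial U_k$ such that the balls $B(x,a_k/3)$, $x\in X_k$, cover $\partial U_k$ and the balls $B(x,a_k/9)$,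 $x\in X_k$, are pairwise disjoint. Let $r_k:=\exp(-\alpha_k^{-1})$ if $d=2$, and $r_k:=a_k\alpha_k^{1/(d-2)}$ if $d\ge3$ (so that $\varphi(r_k)=a_k^{d-2}\alpha_k\le m_k^{1-d}$), and let $r_x:=r_k$ for $x\in X_k$. Fix $k_1\ge k_0$ such that $r_k<a_k/100$ for every $k\ge k_1$ (such $k_1$ exists since $r_k/a_k\to0$). Let $k_2\in\mathbb{N}$, $k_2\ge k_1$, and let $f$ be a strictly positive increasing real function on $(0,m_{k_2}^{1-d}]$ such that $\sum_{k\ge k_2}\beta_kf(\alpha_k^{d-1})<\infty$. Champagne subregion (of a non-empty connected open set $U$): Let $X$ be a countable set in $U$ without accumulation point in $U$, and $r_x\in(0,1)$, $x\in X$, such that the closed balls $\overline B(x,r_x)$ are pairwise disjoint, $\sup_{x\in X}r_x/\mathrm{dist}(x,\partial U)<1$ and, if $U$ is unbounded, $r_x\to0$ as $x\to\infty$. With $A$ the union of all $\overline B(x,r_x)$, $U\setminus A$ is called a champagne subregion of $U$, and $X_A:=X$ is the set of centers of the bubbles forming $A$. Unavoidable: a relatively closed subset $A$ of $U$ is unavoidable if $\mu_y^{U\setminus A}(A)=1$ for every $y\in U\setminus A$, where $\mu_y^{U\setminus A}$ is the harmonic measure at $y$ with respect to $U\setminus A$ (equivalently, Brownian motion starting in $U\setminus A$ and killed when leaving $U$ hits $A$ almost surely). *)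

theory Defs
  imports "HOL-Analysis.Analysis"
begin

text \<open>
  Superharmonic functions on an open set: lower semicontinuous, with the super-mean-value
  property over all closed balls in the set. Means are taken with respect to volume, which gives
  the same class of functions as means over spheres. Only finite-valued functions are considered;
  in the Perron class of bounded boundary data below this loses nothing, since
  an element of the class can be replaced by its minimum with an upper bound of the data.
\<close>

definition superharmonic_on :: "'a::euclidean_space set \<Rightarrow> ('a \<Rightarrow> real) \<Rightarrow> bool" where
  "superharmonic_on V u \<longleftrightarrow>
     (\<forall>x\<in>V. ereal (u x) \<le> Liminf (at x) (\<lambda>z. ereal (u z))) \<and>
     (\<forall>x r. 0 < r \<and> cball x r \<subseteq> V \<longrightarrow>
        set_integrable lborel (cball x r) u \<and>
        (LINT z:cball x r|lborel. u z) / measure lborel (cball x r) \<le> u x)"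

text \<open>
  The upper class for the Dirichlet problem on an open set \<open>V\<close> with bounded boundary data \<open>g\<close>
  (Perron-Wiener-Brelot method). For unbounded \<open>V\<close> the data is extended by \<open>0\<close> to the point at
  infinity; for bounded \<open>V\<close> the last condition is void, the filter being trivial.
\<close>

definition perron_upper_class :: "'a::euclidean_space set \<Rightarrow> ('a \<Rightarrow> real) \<Rightarrow> ('a \<Rightarrow> real) set" where
  "perron_upper_class V g =
     {u. superharmonic_on V u \<and> bdd_below (u ` V) \<and>
         (\<forall>\<zeta>\<in>frontier V. ereal (g \<zeta>) \<le> Liminf (at \<zeta> within V) (\<lambda>z. ereal (u z))) \<and>
         0 \<le> Liminf (inf at_infinity (principal V)) (\<lambda>z. ereal (u z))}"

definition perron_solution :: "'a::euclidean_space set \<Rightarrow> ('a \<Rightarrow> real) \<Rightarrow> 'a \<Rightarrow> ereal" where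
  "perron_solution V g y = (INF u\<in>perron_upper_class V g. ereal (u y))"

text \<open>
  \<open>harmonic_measure V y E\<close> is the harmonic measure at \<open>y \<in> V\<close>, with respect to \<open>V\<close>, of a Borel
  set \<open>E\<close> (more precisely, of the part of \<open>E\<close> on the boundary of \<open>V\<close>): the value at \<open>y\<close> of
  the solution of the Dirichlet problem whose boundary data is the indicator function of \<open>E\<close>.
  Indicator functions of Borel sets are resolutive, so that upper and lower solutions agree and
  no choice is involved. \<open>V\<close> is meant to be an open set having a Green function; in particular
  it may be any bounded open set.
\<close>

definition harmonic_measure :: "'a::euclidean_space set \<Rightarrow> 'a \<Rightarrow> 'a set \<Rightarrow> ereal" where
  "harmonic_measure V y E = perron_solution V (indicator E) y"

definition unavoidable :: "'a::euclidean_space set \<Rightarrow> 'a set \<Rightarrow> bool" where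
  "unavoidable U A \<longleftrightarrow>
     closedin (top_of_set U) A \<and> (\<forall>y\<in>U - A. harmonic_measure (U - A) y A = 1)"

definition bubbles :: "'a::euclidean_space set \<Rightarrow> ('a \<Rightarrow> real) \<Rightarrow> 'a set" where
  "bubbles X r = (\<Union>x\<in>X. cball x (r x))"

text \<open>
  \<open>champagne_subregion U W X r\<close>: \<open>W\<close> is a champagne subregion of \<open>U\<close>, with bubbles of
  centers \<open>x \<in> X\<close> and radii \<open>r x\<close>. If \<open>U\<close> is the whole space then its frontier is empty,
  and as \<open>infdist x {} = 0\<close> and \<open>r x / 0 = 0\<close>, the quotient is \<open>0\<close>, in accordance with
  the distance to the empty set being infinite.
\<close>

definition champagne_subregion ::
    "'a::euclidean_space set \<Rightarrow> 'a set \<Rightarrow> 'a set \<Rightarrow> ('a \<Rightarrow> real) \<Rightarrow> bool" where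
  "champagne_subregion U W X r \<longleftrightarrow>
     U \<noteq> {} \<and> open U \<and> connected U \<and>
     countable X \<and> X \<subseteq> U \<and> (\<forall>z\<in>U. \<not> z islimpt X) \<and>
     (\<forall>x\<in>X. 0 < r x \<and> r x < 1) \<and>
     disjoint_family_on (\<lambda>x. cball x (r x)) X \<and>
     (SUP x\<in>X. ereal (r x / infdist x (frontier U))) < 1 \<and>
     (\<not> bounded U \<longrightarrow> (r \<longlongrightarrow> 0) (inf at_infinity (principal X))) \<and>
     W = U - bubbles X r"

text \<open>The function \<open>\<phi>\<close> for dimension \<open>d\<close>; for \<open>d = 2\<close> it is meant for \<open>0 < t < 1\<close>.\<close>

definition phi :: "nat \<Rightarrow> real \<Rightarrow> real" where
  "phi d t = (if d = 2 then inverse (ln (1 / t)) else t ^ (d - 2))"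

end

theory Submission
  imports Defs
begin

text \<open>
  Let \<open>u\<close> belong to the upper class of the indicator function of \<open>A\<close>. If \<open>u \<ge> 1 - M\<close> inside
  \<open>U\<^sub>k\<^sub>+\<^sub>1\<close>, then \<open>u \<ge> 1 - M (1 - \<kappa> m\<^sub>k \<alpha>\<^sub>k)\<close> inside \<open>U\<^sub>k\<close>, with \<open>\<kappa> > 0\<close> depending only on \<open>d\<close>; as
  \<open>\<Sum> m\<^sub>k \<alpha>\<^sub>k = \<infinity>\<close>, iteration gives \<open>u \<ge> 1\<close>. The gain in one layer comes from a barrier \<open>p\<close>, subharmonic
  off the bubbles of that layer, with \<open>p \<le> 1\<close> off the bubbles, \<open>p = 0\<close> on \<open>\<partial>U\<^sub>k\<^sub>+\<^sub>1\<close> and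
  \<open>p \<ge> \<kappa> m\<^sub>k \<alpha>\<^sub>k\<close> on \<open>U\<^sub>k\<close>. It is \<open>\<alpha>\<^sub>k\<close> times the sum of two terms: a radial function of height about \<open>m\<^sub>k\<close>,
  constant inside and decreasing outside, whose concave bend lies in a shell of width about \<open>a\<^sub>k\<close> at
  \<open>\<partial>U\<^sub>k\<close>; and a fundamental solution plus a small multiple of \<open>\<bar>z - x\<bar>\<^sup>2\<close>, centred at the point \<open>x\<close>
  of \<open>X\<^sub>k\<close> nearest to \<open>z\<close> and truncated at distance \<open>a\<^sub>k\<close>. The latter is a maximum of translates, hence
  can be tested at the nearest center alone, and since \<open>X\<^sub>k\<close> is an \<open>a\<^sub>k/3\<close>-net its positive Laplacian
  outweighs the bend. Comparison needs only that a superharmonic function in the mean value sense is not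
  touched from below by a function with positive Laplacian.

  The sum is controlled by \<open>card X\<^sub>k \<le> C a\<^sub>k\<^sup>1\<^sup>-\<^sup>d\<close>, obtained by comparing volumes in a shell.
\<close>

subsection \<open>Second moments of balls\<close>

text \<open>The map permutes the side lengths of a box, so box volumes are unchanged, and these
  determine the measure. It serves to compare second moments in different directions.\<close>

lemma lborel_distr_transpose:
  fixes b b' :: "'a::euclidean_space"
  assumes "b \<in> Basis" "b' \<in> Basis"
  defines "T \<equiv> \<lambda>x::'a. \<Sum>j\<in>Basis. (x \<bullet> Transposition.transpose b b' j) *\<^sub>R j"
  shows "distr lborel borel T = lborel"
proof (rule lborel_eqI[symmetric])
  let ?p = "Transposition.transpose b b'"
  have pB: "?p j \<in> Basis" if "j \<in> Basis" for j
    using that assms(1,2) by (auto simp: Transposition.transpose_def)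
  have bij: "bij_betw ?p Basis Basis"
    by (rule bij_betwI[where g = ?p]) (auto simp: pB)
  have [measurable]: "T \<in> borel \<rightarrow>\<^sub>M borel"
    by (simp add: T_def)
  have Tj: "T x \<bullet> j = x \<bullet> ?p j" if "j \<in> Basis" for x j
    using that by (simp add: T_def)
  fix l u :: 'a assume le: "\<And>j. j \<in> Basis \<Longrightarrow> l \<bullet> j \<le> u \<bullet> j"
  have eq: "T -` box l u = box (T l) (T u)"
  proof (rule set_eqI)
    fix x
    have "x \<in> T -` box l u \<longleftrightarrow> (\<forall>j\<in>Basis. l \<bullet> j < x \<bullet> ?p j \<and> x \<bullet> ?p j < u \<bullet> j)"
      by (auto simp: mem_box Tj)
    also have "\<dots> \<longleftrightarrow> (\<forall>j\<in>Basis. l \<bullet> ?p j < x \<bullet> j \<and> x \<bullet> j < u \<bullet> ?p j)"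
      using pB by (metis transpose_involutory)
    also have "\<dots> \<longleftrightarrow> x \<in> box (T l) (T u)"
      by (auto simp: mem_box Tj)
    finally show "x \<in> T -` box l u \<longleftrightarrow> x \<in> box (T l) (T u)" .
  qed
  have "emeasure (distr lborel borel T) (box l u) = emeasure lborel (box (T l) (T u))"
    by (simp add: emeasure_distr eq)
  also have "\<dots> = (\<Prod>j\<in>Basis. (T u - T l) \<bullet> j)"
    using le pB by (subst emeasure_lborel_box) (auto simp: Tj inner_simps)
  also have "(\<Prod>j\<in>Basis. (T u - T l) \<bullet> j) = (\<Prod>j\<in>Basis. (u - l) \<bullet> ?p j)"
    by (rule prod.cong) (auto simp: Tj inner_simps)
  also have "\<dots> = (\<Prod>j\<in>Basis. (u - l) \<bullet> j)"
    by (rule prod.reindex_bij_betw[OF bij])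
  finally show "emeasure (distr lborel borel T) (box l u) = (\<Prod>j\<in>Basis. (u - l) \<bullet> j)" .
qed simp

lemma lborel_distr_reflect:
  fixes b :: "'a::euclidean_space"
  assumes b: "b \<in> Basis"
  shows "distr lborel borel (\<lambda>x::'a. \<Sum>j\<in>Basis. ((if j = b then -1 else 1) * (x \<bullet> j)) *\<^sub>R j) = lborel"
proof -
  have "(\<Prod>j\<in>Basis. \<bar>if j = b then - 1 else 1\<bar>) = (1::real)"
    by (intro prod.neutral) auto
  then show ?thesis
    using lborel_affine_euclidean[of "\<lambda>j. if j = b then -1 else 1" "0::'a"]
    by (simp add: density_1)
qed

lemma set_integral_cball_isometry:
  fixes T :: "'a::euclidean_space \<Rightarrow> 'a" and g :: "'a \<Rightarrow> real"
  assumes T: "distr lborel borel T = lborel" and [measurable]: "T \<in> borel_measurable borel"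
    and norm: "\<And>x. norm (T x) = norm x" and [measurable]: "g \<in> borel_measurable borel"
  shows "(LINT x:cball 0 e|lborel. g (T x)) = (LINT x:cball 0 e|lborel. g x)"
proof -
  have ind: "indicator (cball 0 e) (T x) = (indicator (cball 0 e) x :: real)" for x
    by (simp add: indicator_def norm)
  have [measurable]: "cball (0::'a) e \<in> sets borel"
    by simp
  have "(LINT x:cball 0 e|lborel. g x) = (\<integral>x. indicator (cball 0 e) x *\<^sub>R g x \<partial>distr lborel borel T)"
    by (simp add: T set_lebesgue_integral_def)
  also have "\<dots> = (LINT x:cball 0 e|lborel. g (T x))"
    by (subst integral_distr) (auto simp: ind set_lebesgue_integral_def)
  finally show ?thesis ..
qed

lemma set_integral_cball_translate:
  fixes z :: "'a::euclidean_space" and g :: "'a \<Rightarrow> real"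
  assumes [measurable]: "g \<in> borel_measurable borel"
  shows "(LINT x:cball z e|lborel. g (x - z)) = (LINT x:cball 0 e|lborel. g x)"
proof -
  have eq: "indicator (cball z e) (z + x) *\<^sub>R g (z + x - z) = indicator (cball 0 e) x *\<^sub>R g x" for x
    by (simp add: indicator_def dist_norm)
  have [measurable]: "cball z e \<in> sets borel"
    by simp
  have "(LINT x:cball z e|lborel. g (x - z))
      = (\<integral>x. indicator (cball z e) x *\<^sub>R g (x - z) \<partial>distr lborel borel ((+) z))"
    by (simp add: lborel_distr_plus set_lebesgue_integral_def)
  also have "\<dots> = (LINT x:cball 0 e|lborel. g x)"
    by (subst integral_distr) (simp_all only: set_lebesgue_integral_def eq, measurable)
  finally show ?thesis .
qed

lemma norm_eqI_Basis:
  fixes x y :: "'a::euclidean_space"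
  assumes "(\<Sum>j\<in>Basis. (x \<bullet> j)\<^sup>2) = (\<Sum>j\<in>Basis. (y \<bullet> j)\<^sup>2)"
  shows "norm x = norm y"
  using assms by (simp add: norm_eq_sqrt_inner euclidean_inner[of x x] euclidean_inner[of y y] power2_eq_square)

lemma set_integrable_cball_continuous:
  fixes g :: "'a::euclidean_space \<Rightarrow> real"
  assumes "continuous_on (cball z e) g"
  shows "set_integrable lborel (cball z e) g"
  unfolding set_integrable_def using assms
  by (intro borel_integrable_compact) auto

text \<open>Reflecting the coordinate \<open>b\<close> preserves the ball and the measure but
  changes the sign of the integrand, so each integral equals its own negative.\<close>

lemma set_integral_cball_linear:
  fixes b :: "'a::euclidean_space"
  assumes b: "b \<in> Basis"
  shows "(LINT x:cball 0 e|lborel. x \<bullet> b) = 0"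
    and "b' \<in> Basis \<Longrightarrow> b' \<noteq> b \<Longrightarrow> (LINT x:cball 0 e|lborel. (x \<bullet> b) * (x \<bullet> b')) = 0"
proof -
  define T where "T = (\<lambda>x::'a. \<Sum>j\<in>Basis. ((if j = b then -1 else 1) * (x \<bullet> j)) *\<^sub>R j)"
  have T: "distr lborel borel T = lborel"
    unfolding T_def by (rule lborel_distr_reflect[OF b])
  have [measurable]: "T \<in> borel_measurable borel"
    by (simp add: T_def)
  have Tj: "T x \<bullet> j = (if j = b then -1 else 1) * (x \<bullet> j)" if "j \<in> Basis" for x j
    using that by (simp add: T_def)
  have norm: "norm (T x) = norm x" for x
    by (rule norm_eqI_Basis, rule sum.cong) (auto simp: Tj power2_eq_square)
  note I = set_integral_cball_isometry[OF T _ norm]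
  have "(LINT x:cball 0 e|lborel. x \<bullet> b) = (LINT x:cball 0 e|lborel. T x \<bullet> b)"
    using I[of "\<lambda>x. x \<bullet> b" e] by simp
  also have "\<dots> = - (LINT x:cball 0 e|lborel. x \<bullet> b)"
    using b by (simp add: Tj set_lebesgue_integral_def)
  finally show "(LINT x:cball 0 e|lborel. x \<bullet> b) = 0"
    by simp
  assume b': "b' \<in> Basis" "b' \<noteq> b"
  have "(LINT x:cball 0 e|lborel. (x \<bullet> b) * (x \<bullet> b')) = (LINT x:cball 0 e|lborel. (T x \<bullet> b) * (T x \<bullet> b'))"
    using I[of "\<lambda>x. (x \<bullet> b) * (x \<bullet> b')" e] by simp
  also have "\<dots> = - (LINT x:cball 0 e|lborel. (x \<bullet> b) * (x \<bullet> b'))"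
    using b b' by (simp add: Tj set_lebesgue_integral_def)
  finally show "(LINT x:cball 0 e|lborel. (x \<bullet> b) * (x \<bullet> b')) = 0"
    by simp
qed

lemma set_integral_cball_square_eq:
  fixes b b' :: "'a::euclidean_space"
  assumes b: "b \<in> Basis" "b' \<in> Basis"
  shows "(LINT x:cball 0 e|lborel. (x \<bullet> b)\<^sup>2) = (LINT x:cball 0 e|lborel. (x \<bullet> b')\<^sup>2)"
proof -
  let ?p = "Transposition.transpose b b'"
  define T where "T = (\<lambda>x::'a. \<Sum>j\<in>Basis. (x \<bullet> ?p j) *\<^sub>R j)"
  have T: "distr lborel borel T = lborel"
    unfolding T_def by (rule lborel_distr_transpose[OF b])
  have [measurable]: "T \<in> borel_measurable borel"
    by (simp add: T_def)
  have Tj: "T x \<bullet> j = x \<bullet> ?p j" if "j \<in> Basis" for x j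
    using that by (simp add: T_def)
  have pB: "?p j \<in> Basis" if "j \<in> Basis" for j
    using that b by (auto simp: Transposition.transpose_def)
  have bij: "bij_betw ?p Basis Basis"
    by (rule bij_betwI[where g = ?p]) (auto simp: pB)
  have norm: "norm (T x) = norm x" for x
  proof (rule norm_eqI_Basis)
    have "(\<Sum>j\<in>Basis. (T x \<bullet> j)\<^sup>2) = (\<Sum>j\<in>Basis. (x \<bullet> ?p j)\<^sup>2)"
      by (simp add: Tj)
    also have "\<dots> = (\<Sum>j\<in>Basis. (x \<bullet> j)\<^sup>2)"
      by (rule sum.reindex_bij_betw[OF bij])
    finally show "(\<Sum>j\<in>Basis. (T x \<bullet> j)\<^sup>2) = (\<Sum>j\<in>Basis. (x \<bullet> j)\<^sup>2)" .
  qed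
  show ?thesis
    using set_integral_cball_isometry[OF T _ norm, of "\<lambda>x. (x \<bullet> b')\<^sup>2" e] b
    by (simp add: Tj)
qed

text \<open>The integrand is at least \<open>(e / 2)\<^sup>2\<close> on the outer shell
  \<open>S\<close>, which has positive volume.\<close>

lemma set_integral_cball_norm_square_pos:
  assumes "0 < e"
  shows "0 < (LINT x:cball (0::'a::euclidean_space) e|lborel. (norm x)\<^sup>2)"
proof -
  define S where "S = cball (0::'a) e - ball 0 (e / 2)"
  have fin: "emeasure lborel S < \<infinity>"
    unfolding S_def using emeasure_mono[of "cball (0::'a) e - ball 0 (e/2)" "cball 0 e" lborel]
    by (auto simp: emeasure_cball assms less_imp_le intro: le_less_trans)
  have "measure lborel S = measure lborel (cball (0::'a) e) - measure lborel (ball (0::'a) (e / 2))"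
    unfolding S_def using assms by (subst measure_Diff) (auto simp: emeasure_cball emeasure_ball)
  also have "\<dots> = (e ^ DIM('a) - (e / 2) ^ DIM('a)) * unit_ball_vol (DIM('a))"
    using assms by (simp add: content_cball content_ball algebra_simps)
  also have "\<dots> > 0"
    using assms by (simp add: power_strict_mono)
  finally have pos: "0 < measure lborel S" .
  have intS: "set_integrable lborel S (\<lambda>x. (e / 2)\<^sup>2)"
    using fin unfolding set_integrable_def by (simp add: S_def)
  have intN: "set_integrable lborel (cball (0::'a) e) (\<lambda>x. (norm x)\<^sup>2)"
    by (intro set_integrable_cball_continuous continuous_intros)
  have "0 < (e / 2)\<^sup>2 * measure lborel S"
    using pos assms by simp
  also have "\<dots> = (LINT x:S|lborel. (e / 2)\<^sup>2)"
    using fin by (simp add: set_lebesgue_integral_def S_def)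
  also have "\<dots> \<le> (LINT x:cball (0::'a) e|lborel. (norm x)\<^sup>2)"
    unfolding set_lebesgue_integral_def
  proof (rule integral_mono)
    show "integrable lborel (\<lambda>x. indicator S x *\<^sub>R (e / 2)\<^sup>2)"
      "integrable lborel (\<lambda>x. indicator (cball (0::'a) e) x *\<^sub>R (norm x)\<^sup>2)"
      using intS intN unfolding set_integrable_def by auto
    show "indicator S x *\<^sub>R (e / 2)\<^sup>2 \<le> indicator (cball (0::'a) e) x *\<^sub>R (norm x)\<^sup>2" for x
      using assms by (auto simp: S_def indicator_def intro!: power_mono)
  qed
  finally show ?thesis .
qed

lemma set_integral_sum:
  fixes f :: "'i \<Rightarrow> 'b \<Rightarrow> real"
  assumes "\<And>i. i \<in> I \<Longrightarrow> set_integrable M A (f i)"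
  shows "(LINT x:A|M. \<Sum>i\<in>I. f i x) = (\<Sum>i\<in>I. LINT x:A|M. f i x)"
  using assms unfolding set_lebesgue_integral_def set_integrable_def
  by (simp add: sum_distrib_left Bochner_Integration.integral_sum)

text \<open>The second moments of a centred ball are a multiple of the identity, so integrating a
  quadratic form over the ball extracts its trace.\<close>

lemma set_integral_cball_quadratic:
  fixes B :: "'a::euclidean_space \<Rightarrow> 'a \<Rightarrow> real" and l :: 'a
  assumes B: "bilinear B"
  shows "(LINT x:cball 0 e|lborel. l \<bullet> x + B x x) =
    (\<Sum>b\<in>Basis. B b b) * ((LINT x:cball (0::'a) e|lborel. (norm x)\<^sup>2) / DIM('a))"
proof -
  let ?I = "\<lambda>g. LINT x:cball (0::'a) e|lborel. g x :: real"
  obtain c :: 'a where c: "c \<in> Basis"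
    using nonempty_Basis by blast
  define J where "J = ?I (\<lambda>x. (x \<bullet> c)\<^sup>2)"
  have int: "set_integrable lborel (cball (0::'a) e) g" if "continuous_on UNIV g" for g :: "'a \<Rightarrow> real"
    using that by (intro set_integrable_cball_continuous) (rule continuous_on_subset, auto)
  have J: "?I (\<lambda>x. (x \<bullet> b) * (x \<bullet> b')) = (if b = b' then J else 0)" if "b \<in> Basis" "b' \<in> Basis" for b b'
    using set_integral_cball_linear(2)[OF that, of e] set_integral_cball_square_eq[OF that(1) c, of e]
    by (auto simp: J_def power2_eq_square)
  have "?I (\<lambda>x. (norm x)\<^sup>2) = ?I (\<lambda>x. \<Sum>b\<in>Basis. (x \<bullet> b) * (x \<bullet> b))"
    by (simp add: power2_norm_eq_inner euclidean_inner[symmetric])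
  also have "\<dots> = (\<Sum>b\<in>Basis. ?I (\<lambda>x. (x \<bullet> b) * (x \<bullet> b)))"
    by (intro set_integral_sum int continuous_intros)
  also have "\<dots> = DIM('a) * J"
    by (simp add: J)
  finally have N: "J = ?I (\<lambda>x. (norm x)\<^sup>2) / DIM('a)"
    by simp
  have BB: "B x x = (\<Sum>b\<in>Basis. \<Sum>b'\<in>Basis. B b b' * ((x \<bullet> b) * (x \<bullet> b')))" for x
  proof -
    have "B x x = B (\<Sum>b\<in>Basis. (x \<bullet> b) *\<^sub>R b) (\<Sum>b\<in>Basis. (x \<bullet> b) *\<^sub>R b)"
      by (simp add: euclidean_representation)
    also have "\<dots> = (\<Sum>(b,b')\<in>Basis \<times> Basis. B ((x \<bullet> b) *\<^sub>R b) ((x \<bullet> b') *\<^sub>R b'))"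
      by (rule bilinear_sum[OF B])
    also have "\<dots> = (\<Sum>b\<in>Basis. \<Sum>b'\<in>Basis. B b b' * ((x \<bullet> b) * (x \<bullet> b')))"
      by (simp add: sum.cartesian_product bilinear_lmul[OF B] bilinear_rmul[OF B] ac_simps)
    finally show ?thesis .
  qed
  have "?I (\<lambda>x. l \<bullet> x + B x x) = ?I (\<lambda>x. (\<Sum>b\<in>Basis. (l \<bullet> b) * (x \<bullet> b)) +
      (\<Sum>b\<in>Basis. \<Sum>b'\<in>Basis. B b b' * ((x \<bullet> b) * (x \<bullet> b'))))"
    by (simp add: BB euclidean_inner[symmetric])
  also have "\<dots> = ?I (\<lambda>x. \<Sum>b\<in>Basis. (l \<bullet> b) * (x \<bullet> b)) +
      ?I (\<lambda>x. \<Sum>b\<in>Basis. \<Sum>b'\<in>Basis. B b b' * ((x \<bullet> b) * (x \<bullet> b')))"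
    by (intro set_integral_add int continuous_intros)
  also have "?I (\<lambda>x. \<Sum>b\<in>Basis. (l \<bullet> b) * (x \<bullet> b)) = (\<Sum>b\<in>Basis. (l \<bullet> b) * ?I (\<lambda>x. x \<bullet> b))"
    by (subst set_integral_sum) (auto intro!: int continuous_intros)
  also have "?I (\<lambda>x. \<Sum>b\<in>Basis. \<Sum>b'\<in>Basis. B b b' * ((x \<bullet> b) * (x \<bullet> b')))
      = (\<Sum>b\<in>Basis. \<Sum>b'\<in>Basis. B b b' * ?I (\<lambda>x. (x \<bullet> b) * (x \<bullet> b')))"
    by (subst set_integral_sum, (intro int continuous_intros)[],
        rule sum.cong, rule refl, subst set_integral_sum) (auto intro!: int continuous_intros)
  also have "(\<Sum>b\<in>Basis. (l \<bullet> b) * ?I (\<lambda>x. x \<bullet> b)) +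
      (\<Sum>b\<in>Basis. \<Sum>b'\<in>Basis. B b b' * ?I (\<lambda>x. (x \<bullet> b) * (x \<bullet> b'))) = (\<Sum>b\<in>Basis. B b b) * J"
    by (simp add: set_integral_cball_linear J sum_distrib_right if_distrib sum.delta cong: if_cong)
  finally show ?thesis
    by (simp add: N)
qed

subsection \<open>Viscosity subsolutions and comparison with superharmonic functions\<close>

text \<open>The inequality \<open>\<Delta>\<psi>(z) \<ge> \<Lambda>\<close> in the viscosity sense; \<open>B\<close> is half of the Hessian of a
  quadratic polynomial touching \<open>\<psi>\<close> from below at \<open>z\<close>.\<close>

definition laplacian_ge :: "('a::euclidean_space \<Rightarrow> real) \<Rightarrow> 'a \<Rightarrow> real \<Rightarrow> bool" where
  "laplacian_ge \<psi> z \<Lambda> \<longleftrightarrow> (\<exists>l B. bilinear B \<and> \<Lambda> \<le> 2 * (\<Sum>b\<in>Basis. B b b) \<and>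
     (\<forall>\<eta>>0. \<forall>\<^sub>F h in nhds 0. \<psi> z + (l \<bullet> h + B h h) - \<eta> * (norm h)\<^sup>2 \<le> \<psi> (z + h)))"

lemma laplacian_geE:
  assumes "laplacian_ge \<psi> z \<Lambda>"
  obtains l B where "bilinear B" "\<Lambda> \<le> 2 * (\<Sum>b\<in>Basis. B b b)"
    "\<And>\<eta>. \<eta> > 0 \<Longrightarrow> \<forall>\<^sub>F h in nhds 0. \<psi> z + (l \<bullet> h + B h h) - \<eta> * (norm h)\<^sup>2 \<le> \<psi> (z + h)"
  using assms unfolding laplacian_ge_def by blast

section \<open>Calculus rules for the viscosity Laplacian\<close>

lemma bilinear_add_fun:
  assumes "bilinear f" "bilinear g"
  shows "bilinear (\<lambda>x y. f x y + g x y)"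
  using assms unfolding bilinear_def by (auto intro: linear_compose_add)

lemma bilinear_cmult_fun:
  fixes f :: "'a::real_vector \<Rightarrow> 'b::real_vector \<Rightarrow> real"
  assumes "bilinear f"
  shows "bilinear (\<lambda>x y. c * f x y)"
  using assms unfolding bilinear_def by (auto simp: linear_iff algebra_simps)

lemma bilinear_zero: "bilinear (\<lambda>x y. 0)"
  unfolding bilinear_def by (auto simp: linear_iff)

lemma laplacian_ge_add:
  assumes "laplacian_ge \<phi> z a" "laplacian_ge \<psi> z b" "c \<le> a + b"
  shows "laplacian_ge (\<lambda>w. \<phi> w + \<psi> w) z c"
proof -
  obtain B l where B: "bilinear B" "a \<le> 2 * (\<Sum>b\<in>Basis. B b b)"
    "\<And>\<eta>. \<eta> > 0 \<Longrightarrow> \<forall>\<^sub>F h in nhds 0. \<phi> z + (l \<bullet> h + B h h) - \<eta> * (norm h)\<^sup>2 \<le> \<phi> (z + h)"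
    using assms(1) by (rule laplacian_geE) (rule that)
  obtain C k where C: "bilinear C" "b \<le> 2 * (\<Sum>b\<in>Basis. C b b)"
    "\<And>\<eta>. \<eta> > 0 \<Longrightarrow> \<forall>\<^sub>F h in nhds 0. \<psi> z + (k \<bullet> h + C h h) - \<eta> * (norm h)\<^sup>2 \<le> \<psi> (z + h)"
    using assms(2) by (rule laplacian_geE) (rule that)
  have "\<forall>\<^sub>F h in nhds 0. \<phi> z + \<psi> z + ((l + k) \<bullet> h + (B h h + C h h)) - \<eta> * (norm h)\<^sup>2
      \<le> \<phi> (z + h) + \<psi> (z + h)" if "\<eta> > 0" for \<eta>
  proof -
    have "\<eta> / 2 > 0"
      using that by simp
    from B(3)[OF this] C(3)[OF this] show ?thesis
      by eventually_elim (simp add: inner_simps algebra_simps)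
  qed
  moreover have "c \<le> 2 * (\<Sum>b\<in>Basis. B b b + C b b)"
    using B(2) C(2) assms(3) by (simp add: sum.distrib)
  ultimately show ?thesis
    unfolding laplacian_ge_def using bilinear_add_fun[OF B(1) C(1)] by blast
qed

lemma laplacian_ge_cmult:
  assumes "laplacian_ge \<psi> z a" "0 \<le> c" "b \<le> c * a"
  shows "laplacian_ge (\<lambda>w. c * \<psi> w) z b"
\<comment> \<open>The other case divides the tolerance by \<open>c\<close>.\<close>
proof (cases "c = 0")
  case True
  then show ?thesis
    using assms unfolding laplacian_ge_def
    by (intro exI[of _ 0] exI[of _ "\<lambda>x y. 0"]) (auto simp: bilinear_zero)
next
  case False
  obtain B l where B: "bilinear B" "a \<le> 2 * (\<Sum>b\<in>Basis. B b b)"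
    "\<And>\<eta>. \<eta> > 0 \<Longrightarrow> \<forall>\<^sub>F h in nhds 0. \<psi> z + (l \<bullet> h + B h h) - \<eta> * (norm h)\<^sup>2 \<le> \<psi> (z + h)"
    using assms(1) by (rule laplacian_geE) (rule that)
  have c: "c > 0"
    using False assms by simp
  have "\<forall>\<^sub>F h in nhds 0. c * \<psi> z + ((c *\<^sub>R l) \<bullet> h + c * B h h) - \<eta> * (norm h)\<^sup>2 \<le> c * \<psi> (z + h)"
    if "\<eta> > 0" for \<eta>
  proof -
    have "\<forall>\<^sub>F h in nhds 0. \<psi> z + (l \<bullet> h + B h h) - \<eta> / c * (norm h)\<^sup>2 \<le> \<psi> (z + h)"
      using that c by (intro B(3)) auto
    then show ?thesis
    proof eventually_elim
      case (elim h)
      then have "c * (\<psi> z + (l \<bullet> h + B h h) - \<eta> / c * (norm h)\<^sup>2) \<le> c * \<psi> (z + h)"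
        using c by (intro mult_left_mono) auto
      then show ?case
        using c by (simp add: algebra_simps)
    qed
  qed
  moreover have "b \<le> 2 * (\<Sum>b\<in>Basis. c * B b b)"
    using mult_left_mono[OF B(2) assms(2)] assms(3) by (simp add: sum_distrib_left ac_simps)
  ultimately show ?thesis
    unfolding laplacian_ge_def using bilinear_cmult_fun[OF B(1)] by blast
qed

lemma laplacian_ge_const: "laplacian_ge (\<lambda>w. c) z 0"
  unfolding laplacian_ge_def
  by (intro exI[of _ 0] exI[of _ "\<lambda>x y. 0"]) (auto simp: bilinear_zero)

text \<open>A quadratic touching a minorant that agrees at \<open>z\<close> also touches the larger
  function. Functions with kinks therefore need only a smooth minorant through the point under
  test.\<close>

lemma laplacian_ge_mono:
  assumes "laplacian_ge \<phi> z a" "b \<le> a" "\<phi> z = \<psi> z" "\<forall>\<^sub>F w in nhds z. \<phi> w \<le> \<psi> w"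
  shows "laplacian_ge \<psi> z b"
proof -
  obtain B l where B: "bilinear B" "a \<le> 2 * (\<Sum>b\<in>Basis. B b b)"
    "\<And>\<eta>. \<eta> > 0 \<Longrightarrow> \<forall>\<^sub>F h in nhds 0. \<phi> z + (l \<bullet> h + B h h) - \<eta> * (norm h)\<^sup>2 \<le> \<phi> (z + h)"
    using assms(1) by (rule laplacian_geE) (rule that)
  have "((\<lambda>h. z + h) \<longlongrightarrow> z + 0) (nhds 0)"
    by (intro tendsto_intros filterlim_ident)
  then have "\<forall>\<^sub>F h in nhds 0. \<phi> (z + h) \<le> \<psi> (z + h)"
    using assms(4) by (auto simp: filterlim_iff)
  then have "\<forall>\<^sub>F h in nhds 0. \<psi> z + (l \<bullet> h + B h h) - \<eta> * (norm h)\<^sup>2 \<le> \<psi> (z + h)" if "\<eta> > 0" for \<eta>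
    using B(3)[OF that] by eventually_elim (use assms(3) in auto)
  then show ?thesis
    unfolding laplacian_ge_def using B assms(2) by (intro exI[of _ l] exI[of _ B]) auto
qed

text \<open>The mean value inequality is applied to \<open>F\<close> minus its quadratic candidate.
  The derivative of that difference is \<open>F' s\<close> minus its linearization at
  \<open>q\<close>, which is small because \<open>F'\<close> is differentiable at \<open>q\<close>;
  no second derivative elsewhere is involved.\<close>

lemma taylor2_peano_lower:
  fixes F F' :: "real \<Rightarrow> real"
  assumes F: "\<forall>\<^sub>F t in nhds q. (F has_real_derivative F' t) (at t)"
    and F': "(F' has_real_derivative F'') (at q)" and \<eta>: "\<eta> > 0"
  shows "\<forall>\<^sub>F t in nhds q. F q + F' q * (t - q) + F'' / 2 * (t - q)\<^sup>2 - \<eta> * (t - q)\<^sup>2 \<le> F t"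
proof -
  have "\<forall>\<^sub>F t in nhds q. \<bar>F' t - F' q - F'' * (t - q)\<bar> \<le> \<eta> * \<bar>t - q\<bar>"
    using F' \<eta> unfolding has_field_derivative_def has_derivative_within_alt2
    by (auto simp: eventually_at_filter elim!: eventually_mono)
  then have "\<forall>\<^sub>F t in nhds q. \<bar>F' t - F' q - F'' * (t - q)\<bar> \<le> \<eta> * \<bar>t - q\<bar> \<and>
      (F has_real_derivative F' t) (at t)"
    using F by eventually_elim simp
  then obtain d where d: "d > 0" "\<And>t. dist t q < d \<Longrightarrow> \<bar>F' t - F' q - F'' * (t - q)\<bar> \<le> \<eta> * \<bar>t - q\<bar>"
    "\<And>t. dist t q < d \<Longrightarrow> (F has_real_derivative F' t) (at t)"
    unfolding eventually_nhds_metric by blast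
  have "F q + F' q * (t - q) + F'' / 2 * (t - q)\<^sup>2 - \<eta> * (t - q)\<^sup>2 \<le> F t" if t: "dist t q < d" for t
  proof -
    define g where "g = (\<lambda>t. F t - F' q * (t - q) - F'' / 2 * (t - q)\<^sup>2)"
    have "\<bar>g t - g q\<bar> \<le> (\<eta> * \<bar>t - q\<bar>) * \<bar>t - q\<bar>"
    proof -
      have "norm (g t - g q) \<le> (\<eta> * \<bar>t - q\<bar>) * norm (t - q)"
      proof (rule field_differentiable_bound[where S = "closed_segment q t" and f' = "\<lambda>s. F' s - F' q - F'' * (s - q)"])
        fix s assume s: "s \<in> closed_segment q t"
        then have st: "dist s q \<le> dist t q"
          by (metis dist_commute dist_in_closed_segment(1))
        then have sd: "dist s q < d"
          using t by simp
        show "(g has_real_derivative F' s - F' q - F'' * (s - q)) (at s within closed_segment q t)"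
          unfolding g_def
          by (rule DERIV_subset[OF _ subset_UNIV])
             (auto intro!: derivative_eq_intros d(3) sd)
        have "norm (F' s - F' q - F'' * (s - q)) \<le> \<eta> * \<bar>s - q\<bar>"
          using d(2)[OF sd] by simp
        also have "\<dots> \<le> \<eta> * \<bar>t - q\<bar>"
          using st \<eta> by (simp add: dist_real_def)
        finally show "norm (F' s - F' q - F'' * (s - q)) \<le> \<eta> * \<bar>t - q\<bar>" .
      qed auto
      then show ?thesis by simp
    qed
    also have "\<dots> = \<eta> * (t - q)\<^sup>2"
      by (simp add: power2_eq_square)
    finally show ?thesis
      by (auto simp: g_def abs_le_iff)
  qed
  then show ?thesis
    using d(1) unfolding eventually_nhds_metric by blast
qed

text \<open>With v = z - x, the Hessian is 2 F' times the identity plus 4 F'' times v v^T;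
  \<open>B\<close> is half of it, and the bound on \<open>\<Lambda>\<close> is its trace. Using the
  squared norm as argument keeps the formula valid at z = x.\<close>

lemma laplacian_ge_radial:
  fixes z x :: "'a::euclidean_space" and F F' :: "real \<Rightarrow> real"
  assumes F: "\<forall>\<^sub>F t in nhds ((norm (z - x))\<^sup>2). (F has_real_derivative F' t) (at t)"
    and F': "(F' has_real_derivative F'') (at ((norm (z - x))\<^sup>2))"
    and \<Lambda>: "\<Lambda> \<le> 2 * real DIM('a) * F' ((norm (z - x))\<^sup>2) + 4 * (norm (z - x))\<^sup>2 * F''"
  shows "laplacian_ge (\<lambda>w. F ((norm (w - x))\<^sup>2)) z \<Lambda>"
proof -
  define v where "v = z - x"
  define q where "q = (norm v)\<^sup>2"
  define B where "B = (\<lambda>h k. F' q * (h \<bullet> k) + 2 * F'' * ((v \<bullet> h) * (v \<bullet> k)))"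
  define t where "t = (\<lambda>h. (norm (z + h - x))\<^sup>2)"
  have "bilinear B"
    unfolding B_def bilinear_def by (auto simp: linear_iff inner_simps algebra_simps)
  moreover have "(\<Sum>b\<in>Basis. B b b) = DIM('a) * F' q + 2 * F'' * q"
    by (simp add: B_def sum.distrib sum_distrib_left[symmetric] q_def power2_norm_eq_inner
        euclidean_inner[of v v])
  then have "\<Lambda> \<le> 2 * (\<Sum>b\<in>Basis. B b b)"
    using \<Lambda> by (simp add: q_def v_def algebra_simps)
  moreover have "\<forall>\<^sub>F h in nhds 0. F q + ((2 * F' q) *\<^sub>R v \<bullet> h + B h h) - \<eta> * (norm h)\<^sup>2 \<le> F (t h)"
    if \<eta>: "\<eta> > 0" for \<eta>
  proof -
    have tq: "t h - q = 2 * (v \<bullet> h) + (norm h)\<^sup>2" for h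
      by (simp add: t_def q_def v_def power2_norm_eq_inner inner_simps inner_commute)
    \<comment> \<open>For \<open>norm h\<close> at most 1 the increment \<open>t h - q\<close> is
      bounded by \<open>C * norm h\<close>, so with \<open>\<eta>'\<close> the Taylor error uses up
      only half of \<open>\<eta>\<close>.\<close>
    define C where "C = 2 * norm v + 1"
    have C: "C > 0"
      by (simp add: C_def add_nonneg_pos)
    define \<eta>' where "\<eta>' = \<eta> / (2 * C\<^sup>2)"
    have \<eta>': "\<eta>' > 0" "\<eta>' * C\<^sup>2 = \<eta> / 2"
      using \<eta> C by (auto simp: \<eta>'_def)
    have "\<forall>\<^sub>F s in nhds q. F q + F' q * (s - q) + F'' / 2 * (s - q)\<^sup>2 - \<eta>' * (s - q)\<^sup>2 \<le> F s"
      using F F' \<eta>' unfolding q_def v_def by (intro taylor2_peano_lower)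
    moreover have "(t \<longlongrightarrow> t 0) (nhds 0)"
      unfolding t_def by (intro tendsto_intros filterlim_ident)
    then have "(t \<longlongrightarrow> q) (nhds 0)"
      by (simp add: t_def q_def v_def)
    ultimately have ev1: "\<forall>\<^sub>F h in nhds 0.
        F q + F' q * (t h - q) + F'' / 2 * (t h - q)\<^sup>2 - \<eta>' * (t h - q)\<^sup>2 \<le> F (t h)"
      by (auto simp: filterlim_iff)
    \<comment> \<open>Replacing \<open>(t h - q)\<^sup>2\<close> by
      \<open>4 * (v \<bullet> h)\<^sup>2\<close> costs a term of third order in h; within this
      radius it fits into the other half of \<open>\<eta>\<close>.\<close>
    define D where "D = min 1 (\<eta> / (1 + \<bar>F''\<bar> * (4 * norm v + 1)))"
    have D: "D > 0"
      using \<eta> by (simp add: D_def add_pos_nonneg)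
    have ev2: "\<forall>\<^sub>F h in nhds 0. norm (h::'a) < D"
      unfolding eventually_nhds_metric using D by (auto intro!: exI[of _ D])
    from ev1 ev2 show ?thesis
    proof eventually_elim
      case (elim h)
      let ?n = "norm h"
      have n: "?n \<le> 1" "?n * (1 + \<bar>F''\<bar> * (4 * norm v + 1)) \<le> \<eta>"
        using elim(2) by (auto simp: D_def pos_less_divide_eq add_pos_nonneg intro: less_imp_le)
      have vh: "\<bar>v \<bullet> h\<bar> \<le> norm v * ?n"
        by (rule Cauchy_Schwarz_ineq2)
      have n2: "?n\<^sup>2 \<le> ?n"
        using n(1) by (simp add: power2_eq_square mult_left_le)
      have "\<bar>t h - q\<bar> \<le> C * ?n"
      proof -
        have "\<bar>t h - q\<bar> \<le> 2 * \<bar>v \<bullet> h\<bar> + ?n\<^sup>2"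
          unfolding tq using abs_triangle_ineq[of "2 * (v \<bullet> h)" "?n\<^sup>2"] by (simp add: abs_mult)
        then show ?thesis
          using vh n2 by (simp add: C_def algebra_simps)
      qed
      then have "(t h - q)\<^sup>2 \<le> (C * ?n)\<^sup>2"
        using power_mono[of "\<bar>t h - q\<bar>" "C * ?n" 2] by simp
      then have "\<eta>' * (t h - q)\<^sup>2 \<le> \<eta>' * (C * ?n)\<^sup>2"
        using \<eta>' by simp
      also have "\<dots> = \<eta> / 2 * ?n\<^sup>2"
        using \<eta>'(2) by (simp add: power_mult_distrib)
      finally have 1: "\<eta>' * (t h - q)\<^sup>2 \<le> \<eta> / 2 * ?n\<^sup>2" .
      have "\<bar>(t h - q)\<^sup>2 - 4 * (v \<bullet> h)\<^sup>2\<bar> = \<bar>4 * (v \<bullet> h) + ?n\<^sup>2\<bar> * ?n\<^sup>2"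
      proof -
        have "(t h - q)\<^sup>2 - 4 * (v \<bullet> h)\<^sup>2 = (4 * (v \<bullet> h) + ?n\<^sup>2) * ?n\<^sup>2"
          unfolding tq by (simp add: power2_eq_square algebra_simps)
        then show ?thesis
          by (simp add: abs_mult)
      qed
      also have "\<dots> \<le> ((4 * norm v + 1) * ?n) * ?n\<^sup>2"
        using vh n2 abs_triangle_ineq[of "4 * (v \<bullet> h)" "?n\<^sup>2"]
        by (intro mult_right_mono) (auto simp: algebra_simps abs_mult)
      finally have "\<bar>F''\<bar> / 2 * \<bar>(t h - q)\<^sup>2 - 4 * (v \<bullet> h)\<^sup>2\<bar> \<le> \<bar>F''\<bar> / 2 * (((4 * norm v + 1) * ?n) * ?n\<^sup>2)"
        by (intro mult_left_mono) auto
      also have "\<dots> = (?n * (\<bar>F''\<bar> * (4 * norm v + 1))) / 2 * ?n\<^sup>2"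
        by simp
      also have "\<dots> \<le> \<eta> / 2 * ?n\<^sup>2"
        using n(2) by (intro mult_right_mono divide_right_mono) (auto simp: algebra_simps intro: order.trans[rotated])
      finally have "\<bar>F'' / 2 * ((t h - q)\<^sup>2 - 4 * (v \<bullet> h)\<^sup>2)\<bar> \<le> \<eta> / 2 * ?n\<^sup>2"
        by (simp add: abs_mult)
      then have 2: "F'' / 2 * (t h - q)\<^sup>2 \<ge> 2 * F'' * (v \<bullet> h)\<^sup>2 - \<eta> / 2 * ?n\<^sup>2"
        unfolding abs_le_iff right_diff_distrib by linarith
      have 3: "(2 * F' q) *\<^sub>R v \<bullet> h + B h h = F' q * (t h - q) + 2 * F'' * (v \<bullet> h)\<^sup>2"
        unfolding tq B_def by (simp add: power2_norm_eq_inner power2_eq_square[of "v \<bullet> h"] algebra_simps)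
      show ?case
        using elim(1) 1 2 3 by linarith
    qed
  qed
  ultimately show ?thesis
    unfolding laplacian_ge_def t_def q_def v_def by blast
qed

text \<open>Near the touching point u lies above \<open>u z\<close> plus a linear form plus a
  quadratic form of positive trace. Over a small ball the linear form integrates to 0 and the
  quadratic one to a positive number, against the super-mean-value property.\<close>

lemma superharmonic_on_not_touched:
  fixes z :: "'a::euclidean_space"
  assumes u: "superharmonic_on V u" and V: "open V" "z \<in> V"
    and \<psi>: "laplacian_ge \<psi> z \<Lambda>" "0 < \<Lambda>"
    and touch: "\<And>w. w \<in> V \<Longrightarrow> u z - \<psi> z \<le> u w - \<psi> w"
  shows False
proof -
  obtain B l where B: "bilinear B" "\<Lambda> \<le> 2 * (\<Sum>b\<in>Basis. B b b)"
    "\<And>\<eta>. \<eta> > 0 \<Longrightarrow> \<forall>\<^sub>F h in nhds 0. \<psi> z + (l \<bullet> h + B h h) - \<eta> * (norm h)\<^sup>2 \<le> \<psi> (z + h)"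
    using \<psi>(1) by (rule laplacian_geE) (rule that)
  define \<tau> where "\<tau> = (\<Sum>b\<in>Basis. B b b)"
  have \<tau>: "\<tau> > 0"
    using B(2) \<psi>(2) by (simp add: \<tau>_def)
  \<comment> \<open>The trace contributes \<open>\<tau> / DIM('a)\<close> times the second moment;
    this tolerance takes away exactly half of it.\<close>
  define \<eta> where "\<eta> = \<tau> / (2 * DIM('a))"
  have \<eta>: "\<eta> > 0"
    using \<tau> by (simp add: \<eta>_def)
  obtain d where d: "d > 0" "\<And>h. dist h 0 < d \<Longrightarrow> \<psi> z + (l \<bullet> h + B h h) - \<eta> * (norm h)\<^sup>2 \<le> \<psi> (z + h)"
    using B(3)[OF \<eta>] unfolding eventually_nhds_metric by blast
  obtain e0 where e0: "e0 > 0" "cball z e0 \<subseteq> V"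
    using V open_contains_cball by blast
  define e where "e = min e0 (d / 2)"
  have e: "e > 0" "e < d" "cball z e \<subseteq> V"
    using d e0 by (auto simp: e_def)
  define g where "g = (\<lambda>h. (l \<bullet> h + B h h) - \<eta> * (norm h)\<^sup>2)"
  have contB: "continuous_on S (\<lambda>h. B h h)" for S
    using bilinear_continuous_on_compose[OF continuous_on_id continuous_on_id B(1)] by simp
  have contg: "continuous_on S g" for S
    unfolding g_def by (intro continuous_intros contB)
  have int: "set_integrable lborel (cball z e) u"
    and mean: "(LINT w:cball z e|lborel. u w) / measure lborel (cball z e) \<le> u z"
    using u e unfolding superharmonic_on_def by auto
  have m: "measure lborel (cball z e) > 0"
    using e by (simp add: content_cball)
  let ?N = "LINT x:cball (0::'a) e|lborel. (norm x)\<^sup>2"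
  have int1: "set_integrable lborel (cball 0 e) (\<lambda>h. l \<bullet> h + B h h)"
    by (intro set_integrable_cball_continuous continuous_intros contB)
  have int2: "set_integrable lborel (cball (0::'a) e) (\<lambda>h. \<eta> * (norm h)\<^sup>2)"
    by (intro set_integrable_cball_continuous continuous_intros)
  have "(LINT h:cball 0 e|lborel. g h) = \<tau> * (?N / DIM('a)) - \<eta> * ?N"
    unfolding g_def using int1 int2
    by (subst set_integral_diff) (simp_all add: set_integral_cball_quadratic[OF B(1)] \<tau>_def)
  also have "\<dots> = \<eta> * ?N"
    by (simp add: \<eta>_def field_simps)
  also have "\<dots> > 0"
    using \<eta> set_integral_cball_norm_square_pos[OF e(1)] by (intro mult_pos_pos)
  finally have pos: "(LINT w:cball z e|lborel. g (w - z)) > 0"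
    using contg by (subst set_integral_cball_translate)
      (auto intro: borel_measurable_continuous_onI)
  have intg: "set_integrable lborel (cball z e) (\<lambda>w. g (w - z))"
    by (intro set_integrable_cball_continuous continuous_on_compose2[OF contg[of UNIV]] continuous_intros) auto
  have intc: "set_integrable lborel (cball z e) (\<lambda>w. u z)"
    by (intro set_integrable_cball_continuous continuous_intros)
  have "u z * measure lborel (cball z e) < (LINT w:cball z e|lborel. u z) + (LINT w:cball z e|lborel. g (w - z))"
    using pos by (simp add: set_lebesgue_integral_def emeasure_cball e less_imp_le)
  also have "\<dots> = (LINT w:cball z e|lborel. u z + g (w - z))"
    by (rule set_integral_add(2)[OF intc intg, symmetric])
  also have "\<dots> \<le> (LINT w:cball z e|lborel. u w)"
  proof (rule set_integral_mono[OF set_integral_add(1)[OF intc intg] int])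
    fix w assume w: "w \<in> cball z e"
    then have "dist (w - z) 0 < d"
      using e by (simp add: dist_norm norm_minus_commute)
    from d(2)[OF this] have "\<psi> z + g (w - z) \<le> \<psi> w"
      by (simp add: g_def)
    then show "u z + g (w - z) \<le> u w"
      using touch[of w] w e(3) by auto
  qed
  also have "\<dots> \<le> u z * measure lborel (cball z e)"
    using mean m by (simp add: field_simps)
  finally show False by simp
qed

lemma superharmonic_on_subset:
  assumes "superharmonic_on V u" "W \<subseteq> V"
  shows "superharmonic_on W u"
  using assms unfolding superharmonic_on_def by blast

text \<open>Suppose \<open>u - \<psi>\<close> has negative infimum \<open>s\<close>, and let a
  minimizing sequence converge to \<open>\<zeta>\<close>. If \<open>\<zeta>\<close> lies in W, lower
  semicontinuity makes the infimum attained there, so u is touched from below; if not, the boundary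
  condition is violated.\<close>

lemma superharmonic_on_comparison:
  fixes W :: "'a::euclidean_space set"
  assumes u: "superharmonic_on W u" "bdd_below (u ` W)" and W: "open W" "bounded W"
    and cont: "continuous_on (closure W) \<psi>"
    and lap: "\<And>z. z \<in> W \<Longrightarrow> \<exists>\<Lambda>>0. laplacian_ge \<psi> z \<Lambda>"
    and bdry: "\<And>\<zeta>. \<zeta> \<in> frontier W \<Longrightarrow> ereal (\<psi> \<zeta>) \<le> Liminf (at \<zeta> within W) (\<lambda>z. ereal (u z))"
    and y: "y \<in> W"
  shows "\<psi> y \<le> u y"
proof (rule ccontr)
  assume "\<not> \<psi> y \<le> u y"
  then have neg: "u y - \<psi> y < 0" by simp
  define D where "D = (\<lambda>w. u w - \<psi> w) ` W"
  have compact: "compact (closure W)"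
    using W by simp
  then have "bounded (\<psi> ` closure W)"
    using cont compact_continuous_image compact_imp_bounded by blast
  then obtain K where K: "\<And>w. w \<in> closure W \<Longrightarrow> \<bar>\<psi> w\<bar> \<le> K"
    unfolding bounded_iff by auto
  obtain L where L: "\<And>w. w \<in> W \<Longrightarrow> L \<le> u w"
    using u(2) unfolding bdd_below_def by auto
  have bdd: "bdd_below D"
  proof (rule bdd_belowI)
    fix t assume "t \<in> D"
    then obtain w where "w \<in> W" "t = u w - \<psi> w" by (auto simp: D_def)
    then show "L - K \<le> t"
      using L[of w] K[of w] closure_subset[of W] by (force simp: abs_le_iff)
  qed
  define s where "s = Inf D"
  have sle: "s \<le> u w - \<psi> w" if "w \<in> W" for w
    unfolding s_def using bdd that by (intro cInf_lower) (auto simp: D_def)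
  have s0: "s < 0"
    using sle[OF y] neg by simp
  have "\<exists>w\<in>W. u w - \<psi> w < s + 1 / Suc n" for n
    using cInf_lessD[of D "s + 1 / Suc n"] y by (auto simp: D_def s_def)
  then obtain w where w: "\<And>n. w n \<in> W" "\<And>n. u (w n) - \<psi> (w n) < s + 1 / Suc n"
    by metis
  then have "\<And>n. w n \<in> closure W"
    using closure_subset by blast
  then obtain \<zeta> \<sigma> where \<zeta>: "\<zeta> \<in> closure W" "strict_mono (\<sigma> :: nat \<Rightarrow> nat)" "(w \<circ> \<sigma>) \<longlonglongrightarrow> \<zeta>"
    using compact unfolding compact_def by metis
  have \<psi>lim: "(\<lambda>n. \<psi> (w (\<sigma> n))) \<longlonglongrightarrow> \<psi> \<zeta>"
    using \<zeta> w closure_subset[of W]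
    by (intro continuous_on_tendsto_compose[OF cont]) (auto simp: o_def intro!: always_eventually)
  have "(\<lambda>n. s + 1 / Suc n) \<longlonglongrightarrow> s + 0"
    by (intro tendsto_add tendsto_const LIMSEQ_inverse_real_of_nat[unfolded inverse_eq_divide])
  then have "(\<lambda>n. s + 1 / Suc (\<sigma> n)) \<longlonglongrightarrow> s"
    using LIMSEQ_subseq_LIMSEQ[OF _ \<zeta>(2)] by (fastforce simp: o_def)
  then have lim: "(\<lambda>n. s + 1 / Suc (\<sigma> n) + \<psi> (w (\<sigma> n))) \<longlonglongrightarrow> s + \<psi> \<zeta>"
    using \<psi>lim by (intro tendsto_add)
  \<comment> \<open>Serves both cases: an eventual strict lower bound for u along the subsequence
    survives in the limit.\<close>
  have upper: "c \<le> s + \<psi> \<zeta>" if "\<forall>\<^sub>F n in sequentially. c < u (w (\<sigma> n))" for c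
  proof (rule tendsto_lowerbound[OF lim])
    show "\<forall>\<^sub>F n in sequentially. c \<le> s + 1 / Suc (\<sigma> n) + \<psi> (w (\<sigma> n))"
      using that by eventually_elim (use w(2) in \<open>smt (verit)\<close>)
  qed simp
  show False
  proof (cases "\<zeta> \<in> W")
    case True
    have "u \<zeta> \<le> s + \<psi> \<zeta>"
    proof (rule dense_le)
      fix c assume c: "c < u \<zeta>"
      have "ereal c < Liminf (at \<zeta>) (\<lambda>z. ereal (u z))"
        using u(1) True c unfolding superharmonic_on_def by (metis less_ereal.simps(1) order.strict_trans2)
      then have "\<forall>\<^sub>F z in at \<zeta>. c < u z"
        by (auto dest!: less_LiminfD)
      then have "\<forall>\<^sub>F z in nhds \<zeta>. c < u z"
        using c by (auto simp: eventually_at_filter elim: eventually_mono)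
      then have "\<forall>\<^sub>F n in sequentially. c < u ((w \<circ> \<sigma>) n)"
        using \<zeta>(3) unfolding filterlim_iff by blast
      then show "c \<le> s + \<psi> \<zeta>"
        by (intro upper) simp
    qed
    moreover obtain \<Lambda> where "\<Lambda> > 0" "laplacian_ge \<psi> \<zeta> \<Lambda>"
      using lap True by blast
    ultimately show False
      using superharmonic_on_not_touched[OF u(1) W(1) True, of \<psi> \<Lambda>] sle by force
  next
    case False
    then have fr: "\<zeta> \<in> frontier W"
      using \<zeta>(1) W(1) by (simp add: frontier_def interior_open)
    \<comment> \<open>As \<open>s\<close> is negative, \<open>s / 2\<close> leaves room on both
      sides: it gives the strict inequality needed to unfold the Liminf, and it still exceeds
      \<open>s\<close>.\<close>
    have "ereal (\<psi> \<zeta> + s / 2) < Liminf (at \<zeta> within W) (\<lambda>z. ereal (u z))"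
      using bdry[OF fr] s0 by (intro less_le_trans[OF _ bdry[OF fr]]) simp
    then have "\<forall>\<^sub>F z in at \<zeta> within W. \<psi> \<zeta> + s / 2 < u z"
      by (auto dest!: less_LiminfD)
    then have "\<forall>\<^sub>F z in nhds \<zeta>. z \<in> W \<longrightarrow> \<psi> \<zeta> + s / 2 < u z"
      using False by (auto simp: eventually_at_filter elim!: eventually_mono)
    then have "\<forall>\<^sub>F n in sequentially. (w \<circ> \<sigma>) n \<in> W \<longrightarrow> \<psi> \<zeta> + s / 2 < u ((w \<circ> \<sigma>) n)"
      using \<zeta>(3) unfolding filterlim_iff by blast
    then have "\<psi> \<zeta> + s / 2 \<le> s + \<psi> \<zeta>"
      using w(1) by (intro upper) simp
    then show False
      using s0 by simp
  qed
qed

subsection \<open>Building blocks of the barrier\<close>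

text \<open>As a function of \<open>s = \<bar>x\<bar>\<^sup>2\<close>, this is a multiple of the fundamental solution of the Laplacian
  plus \<open>\<bar>x\<bar>\<^sup>2 / 4\<close>.\<close>

definition kern :: "nat \<Rightarrow> real \<Rightarrow> real" where
  "kern d s = (if d = 2 then - ln s / 2 else s powr (- (real d - 2) / 2) / (real d - 2)) + s / 4"

text \<open>The derivative of \<open>kern d\<close>; unlike \<open>kern\<close>, it has the same
  form for d = 2 and d \<ge> 3.\<close>

definition kern' :: "nat \<Rightarrow> real \<Rightarrow> real" where
  "kern' d s = 1 / 4 - s powr (- real d / 2) / 2"

lemma kern_has_derivative:
  assumes "2 \<le> d" "0 < s"
  shows "(kern d has_real_derivative kern' d s) (at s)"
proof (cases "d = 2")
  case True
  have "((\<lambda>s. - ln s / 2 + s / 4) has_real_derivative 1 / 4 - s powr (- 1) / 2) (at s)"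
    using assms by (auto intro!: derivative_eq_intros simp: powr_minus field_simps)
  then show ?thesis
    unfolding kern_def[abs_def] kern'_def using True by simp
next
  case False
  have "- (real d - 2) / 2 - 1 = - real d / 2"
    by (simp add: field_simps)
  then have "((\<lambda>s. s powr (- (real d - 2) / 2) / (real d - 2) + s / 4) has_real_derivative
      (- (real d - 2) / 2 * s powr (- real d / 2)) / (real d - 2) + 1 / 4) (at s)"
    using assms False by (auto intro!: derivative_eq_intros)
  moreover have "(- (real d - 2) / 2 * s powr (- real d / 2)) / (real d - 2) = - (s powr (- real d / 2) / 2)"
  proof -
    have "real d - 2 \<noteq> 0"
      using False by simp
    then show ?thesis
      by (simp add: field_simps)
  qed
  ultimately show ?thesis
    unfolding kern_def[abs_def] kern'_def using False by simp
qed

lemma kern'_has_derivative: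
  assumes "0 < s"
  shows "(kern' d has_real_derivative real d / 4 * s powr (- real d / 2 - 1)) (at s)"
  unfolding kern'_def[abs_def] using assms
  by (auto intro!: derivative_eq_intros simp: field_simps)

text \<open>On (0, 1] the power of s is at least 1, so the fundamental solution outweighs the added
  quadratic and the derivative is negative.\<close>

lemma kern_antimono:
  assumes "2 \<le> d" "0 < s" "s \<le> t" "t \<le> 1"
  shows "kern d t \<le> kern d s"
proof (rule DERIV_nonpos_imp_nonincreasing[OF assms(3)])
  fix x assume x: "s \<le> x" "x \<le> t"
  then have "1 \<le> x powr (- real d / 2)"
    using assms by (simp add: ge_one_powr_ge_zero powr_minus_divide powr_le1 le_divide_eq flip: minus_divide_left)
  then have "kern' d x \<le> 0"
    by (simp add: kern'_def)
  then show "\<exists>y. (kern d has_real_derivative y) (at x) \<and> y \<le> 0"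
    using kern_has_derivative[OF assms(1), of x] assms x by auto
qed

lemma kern_one_nonneg: "2 \<le> d \<Longrightarrow> 0 \<le> kern d 1"
  by (simp add: kern_def)

lemma continuous_on_kern:
  assumes "2 \<le> d" "S \<subseteq> {0<..}"
  shows "continuous_on S (kern d)"
  by (rule DERIV_continuous_on[where D = "kern' d"],
      rule has_field_derivative_at_within, rule kern_has_derivative) (use assms in auto)

text \<open>Since \<open>kern\<close> decreases on (0, 1], inserting the distance to the set of
  centers amounts to taking the maximum of the kernels over all centers. The \<open>min\<close> and
  the subtracted constant cut it off to 0 from distance \<open>a\<close> on.\<close>

definition bump :: "'a::euclidean_space set \<Rightarrow> real \<Rightarrow> 'a \<Rightarrow> real" where
  "bump X a z = kern DIM('a) (min 1 ((infdist z X)\<^sup>2 / a\<^sup>2)) - kern DIM('a) 1"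

text \<open>The centers are excluded: there \<open>ln\<close> and \<open>powr\<close> take the
  default value 0 and the bump is negative instead of infinite.\<close>

lemma bump_nonneg:
  fixes z :: "'a::euclidean_space"
  assumes "2 \<le> DIM('a)" "0 < a" "0 < infdist z X"
  shows "0 \<le> bump X a z"
  unfolding bump_def diff_ge_0_iff_ge using assms
  by (intro kern_antimono) (auto simp: min_le_iff_disj)

lemma bump_far:
  assumes "0 < a" "a \<le> infdist z X"
  shows "bump X a z = 0"
proof -
  have "1 \<le> (infdist z X)\<^sup>2 / a\<^sup>2"
    using assms by (simp add: le_divide_eq power_mono)
  then show ?thesis
    by (simp add: bump_def)
qed

lemma bump_le:
  fixes z :: "'a::euclidean_space"
  assumes "2 \<le> DIM('a)" "0 < \<rho>" "\<rho> \<le> infdist z X" "\<rho> \<le> a"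
  shows "bump X a z \<le> kern DIM('a) (\<rho>\<^sup>2 / a\<^sup>2) - kern DIM('a) 1"
  unfolding bump_def using assms
  by (intro diff_right_mono kern_antimono)
     (auto simp: divide_le_eq intro!: divide_right_mono power_mono)

lemma continuous_on_bump:
  assumes "2 \<le> DIM('a)" "0 < a" "\<And>z. z \<in> S \<Longrightarrow> 0 < infdist z X"
  shows "continuous_on S (bump (X::'a::euclidean_space set) a)"
proof -
  have 1: "continuous_on {0<..} (kern DIM('a))"
    using assms by (intro continuous_on_kern) auto
  have 2: "continuous_on S (\<lambda>z. min 1 ((infdist z X)\<^sup>2 / a\<^sup>2))"
    using assms(2) by (intro continuous_intros) auto
  have "(\<lambda>z. min 1 ((infdist z X)\<^sup>2 / a\<^sup>2)) ` S \<subseteq> {0<..}"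
    using assms by fastforce
  from continuous_on_diff[OF continuous_on_compose2[OF 1 2 this] continuous_on_const] show ?thesis
    unfolding bump_def[abs_def] .
qed

lemma eventually_infdist_pos:
  fixes z :: "'a::euclidean_space"
  assumes "0 < infdist z X"
  shows "\<forall>\<^sub>F w in nhds z. 0 < infdist w X"
proof -
  have "((\<lambda>w. infdist w X) \<longlongrightarrow> infdist z X) (nhds z)"
    by (intro tendsto_infdist filterlim_ident)
  then show ?thesis
    using assms by (rule order_tendstoD)
qed

text \<open>Here the bump attains its minimum 0 over the points off the centers, so the constant 0
  touches it from below.\<close>

lemma laplacian_bump_far:
  fixes z :: "'a::euclidean_space"
  assumes "2 \<le> DIM('a)" "0 < a" "a \<le> infdist z X"
  shows "laplacian_ge (bump X a) z 0"
proof (rule laplacian_ge_mono[OF laplacian_ge_const])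
  show "0 = bump X a z"
    using bump_far assms by simp
  show "\<forall>\<^sub>F w in nhds z. 0 \<le> bump X a w"
    using eventually_infdist_pos[of z X] assms
    by (auto elim!: eventually_mono intro: bump_nonneg)
qed simp

text \<open>Near \<open>z\<close> the bump lies above the kernel centred at the point of \<open>X\<close> nearest to \<open>z\<close>.\<close>

lemma laplacian_bump_near:
  fixes z :: "'a::euclidean_space"
  assumes d: "2 \<le> DIM('a)" and a: "0 < a" and z: "0 < infdist z X" "infdist z X < a"
    and X: "finite X" "X \<noteq> {}"
  shows "laplacian_ge (bump X a) z (real DIM('a) / (2 * a\<^sup>2))"
proof -
  let ?d = "DIM('a)"
  obtain x where x: "x \<in> X" "infdist z X = norm (z - x)"
    using infdist_attains_inf[OF finite_imp_closed[OF X(1)] X(2), of z] by (auto simp: dist_norm)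
  define q where "q = (norm (z - x))\<^sup>2"
  have q: "0 < q" "q < a\<^sup>2"
    using z x by (auto simp: q_def power_strict_mono)
  define F where "F = (\<lambda>t. kern ?d (t / a\<^sup>2) - kern ?d 1)"
  define F' where "F' = (\<lambda>t. kern' ?d (t / a\<^sup>2) / a\<^sup>2)"
  define F'' where "F'' = (real ?d / 4 * (q / a\<^sup>2) powr (- real ?d / 2 - 1) / a\<^sup>2) / a\<^sup>2"
  have "laplacian_ge (\<lambda>w. F ((norm (w - x))\<^sup>2)) z (real ?d / (2 * a\<^sup>2))"
  proof (rule laplacian_ge_radial)
    have D: "(F has_real_derivative F' t) (at t)" if "t > 0" for t
    proof -
      have "((\<lambda>t. kern ?d (t / a\<^sup>2)) has_real_derivative kern' ?d (t / a\<^sup>2) * (1 / a\<^sup>2)) (at t)"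
        using that a d
        by (intro DERIV_chain2[OF kern_has_derivative] DERIV_cdivide DERIV_ident) auto
      from DERIV_diff[OF this DERIV_const[of "kern ?d 1"]] show ?thesis
        unfolding F_def F'_def by simp
    qed
    show "\<forall>\<^sub>F t in nhds ((norm (z - x))\<^sup>2). (F has_real_derivative F' t) (at t)"
      using q D unfolding q_def[symmetric]
      by (intro eventually_mono[OF eventually_nhds_in_open[of "{0<..}"]]) auto
    show "(F' has_real_derivative F'') (at ((norm (z - x))\<^sup>2))"
    proof -
      have "((\<lambda>t. kern' ?d (t / a\<^sup>2)) has_real_derivative
          real ?d / 4 * (q / a\<^sup>2) powr (- real ?d / 2 - 1) * (1 / a\<^sup>2)) (at q)"
        using q a by (intro DERIV_chain2[OF kern'_has_derivative] DERIV_cdivide DERIV_ident) auto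
      from DERIV_cdivide[OF this, of "a\<^sup>2"] show ?thesis
        unfolding q_def[symmetric] F'_def F''_def by simp
    qed
    \<comment> \<open>This makes the two contributions of the fundamental solution cancel; what
      remains is the Laplacian of the quadratic term, scaled by \<open>a\<close>.\<close>
    have P: "(q / a\<^sup>2) powr (- real ?d / 2 - 1) * (q / a\<^sup>2) = (q / a\<^sup>2) powr (- real ?d / 2)"
      using q a by (simp add: powr_diff)
    have "2 * real ?d * F' q + 4 * q * F''
        = (2 * real ?d * kern' ?d (q / a\<^sup>2) + real ?d * ((q / a\<^sup>2) powr (- real ?d / 2 - 1) * (q / a\<^sup>2))) / a\<^sup>2"
      using a by (simp add: F'_def F''_def field_simps)
    also have "\<dots> = real ?d / (2 * a\<^sup>2)"
      unfolding P by (simp add: kern'_def algebra_simps)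
    finally show "real ?d / (2 * a\<^sup>2) \<le> 2 * real ?d * F' ((norm (z - x))\<^sup>2) + 4 * (norm (z - x))\<^sup>2 * F''"
      unfolding q_def by simp
  qed
  then show ?thesis
  proof (rule laplacian_ge_mono)
    show "F ((norm (z - x))\<^sup>2) = bump X a z"
    proof -
      have "q / a\<^sup>2 \<le> 1"
        using q a by (simp add: divide_le_eq)
      then show ?thesis
        using x by (simp add: F_def bump_def q_def min_absorb2)
    qed
    have "((\<lambda>w. norm (w - x)) \<longlongrightarrow> norm (z - x)) (nhds z)"
      by (intro tendsto_intros filterlim_ident)
    then have "\<forall>\<^sub>F w in nhds z. norm (w - x) < a"
      using z x by (intro order_tendstoD) auto
    with eventually_infdist_pos[OF z(1)] show "\<forall>\<^sub>F w in nhds z. F ((norm (w - x))\<^sup>2) \<le> bump X a w"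
    proof eventually_elim
      case (elim w)
      have le: "infdist w X \<le> norm (w - x)"
        using infdist_le[OF x(1), of w] by (simp add: dist_norm)
      have 1: "(norm (w - x))\<^sup>2 / a\<^sup>2 \<le> 1"
        using elim a by (simp add: divide_le_eq power_mono less_imp_le)
      have 2: "(infdist w X)\<^sup>2 / a\<^sup>2 \<le> (norm (w - x))\<^sup>2 / a\<^sup>2"
        using le elim by (intro divide_right_mono power_mono) auto
      show ?case
        unfolding F_def bump_def using elim a d 1 2 by (intro diff_right_mono kern_antimono) auto
    qed
  qed simp
qed

text \<open>A concave cutoff that is continuously differentiable: its slope falls linearly from 1 to
  0 on [0, 1]. The bend is thus spread out, with second derivative -1 there, instead of forming a
  downward kink.\<close>

definition ramp :: "real \<Rightarrow> real" where
  "ramp v = (if v \<le> 0 then v else if v \<le> 1 then v - v\<^sup>2 / 2 else 1 / 2)"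

text \<open>Holds on the whole line, so the parabola can be used as a touching function on all of
  [0, 1], including both ends.\<close>

lemma ramp_ge_parabola: "v - v\<^sup>2 / 2 \<le> ramp v"
  using zero_le_power2[of "v - 1"] by (auto simp: ramp_def power2_diff)

lemma ramp_le_half: "ramp v \<le> 1 / 2"
  using zero_le_power2[of "v - 1"] by (auto simp: ramp_def power2_diff)

lemma ramp_nonneg:
  assumes "0 \<le> v"
  shows "0 \<le> ramp v"
proof -
  have "v\<^sup>2 \<le> 2 * v" if "v \<le> 1"
    using mult_mono[of v 2 v v] that assms by (simp add: power2_eq_square)
  then show ?thesis
    using assms by (auto simp: ramp_def)
qed

lemma continuous_on_ramp: "continuous_on S ramp"
proof -
  \<comment> \<open>The clamped formula replaces gluing three continuous pieces.\<close>
  have eq: "ramp = (\<lambda>v. let w = min 1 (max 0 v) in min v 0 + (w - w\<^sup>2 / 2))"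
    by (auto simp: ramp_def Let_def min_def max_def fun_eq_iff)
  show ?thesis
    unfolding eq Let_def by (intro continuous_intros) auto
qed

text \<open>The argument \<open>t\<close> stands for the squared norm. In a layer, \<open>c\<close>
  makes the height vanish at norm \<open>R\<close>, and the division by \<open>a\<close> squeezes
  the range [0, 1] into a shell of width at most a / 2.\<close>

definition height :: "real \<Rightarrow> real \<Rightarrow> real \<Rightarrow> real \<Rightarrow> real" where
  "height \<gamma> c a t = (exp (\<gamma> * (1 - t)) - c) / a"

lemma height_has_derivative:
  "(height \<gamma> c a has_real_derivative - \<gamma> * exp (\<gamma> * (1 - t)) / a) (at t)"
  unfolding height_def[abs_def] by (auto intro!: derivative_eq_intros simp: divide_inverse)

lemma height_has_derivative2:
  "((\<lambda>t. - \<gamma> * exp (\<gamma> * (1 - t)) / a) has_real_derivative \<gamma>\<^sup>2 * exp (\<gamma> * (1 - t)) / a) (at t)"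
  by (auto intro!: derivative_eq_intros simp: power2_eq_square divide_inverse)

lemma eventually_height:
  fixes z :: "'a::euclidean_space"
  assumes "open S" "height \<gamma> c a ((norm z)\<^sup>2) \<in> S"
  shows "\<forall>\<^sub>F w in nhds z. height \<gamma> c a ((norm w)\<^sup>2) \<in> S"
proof -
  have "((\<lambda>w. height \<gamma> c a ((norm w)\<^sup>2)) \<longlongrightarrow> height \<gamma> c a ((norm z)\<^sup>2)) (nhds z)"
    unfolding height_def divide_inverse by (intro tendsto_intros filterlim_ident)
  then show ?thesis
    using assms by (rule topological_tendstoD)
qed

text \<open>The expression is a positive multiple of \<open>2 * \<gamma> * q - real d\<close>: for
  large \<open>\<gamma>\<close> the second derivative wins away from the origin.\<close>

lemma height_laplacian_nonneg:
  assumes "0 < a" "0 < \<gamma>" "real d \<le> 2 * \<gamma> * q"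
  shows "0 \<le> 2 * real d * (- \<gamma> * exp (\<gamma> * (1 - q)) / a) + 4 * q * (\<gamma>\<^sup>2 * exp (\<gamma> * (1 - q)) / a)"
proof -
  have "2 * real d * (- \<gamma> * exp (\<gamma> * (1 - q)) / a) + 4 * q * (\<gamma>\<^sup>2 * exp (\<gamma> * (1 - q)) / a)
      = 2 * \<gamma> * exp (\<gamma> * (1 - q)) / a * (2 * \<gamma> * q - real d)"
    using assms(1) by (simp add: field_simps power2_eq_square)
  also have "\<dots> \<ge> 0"
    using assms by (intro mult_nonneg_nonneg) auto
  finally show ?thesis .
qed

lemma laplacian_ramp_outside:
  fixes z :: "'a::euclidean_space"
  assumes "0 < a" "0 < \<gamma>" "real DIM('a) \<le> 2 * \<gamma> * (norm z)\<^sup>2" "height \<gamma> c a ((norm z)\<^sup>2) < 0"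
  shows "laplacian_ge (\<lambda>w. ramp (height \<gamma> c a ((norm w)\<^sup>2))) z 0"
proof (rule laplacian_ge_mono)
  show "laplacian_ge (\<lambda>w. height \<gamma> c a ((norm (w - 0))\<^sup>2)) z 0"
    using height_laplacian_nonneg[OF assms(1-3)]
    by (intro laplacian_ge_radial[where F' = "\<lambda>t. - \<gamma> * exp (\<gamma> * (1 - t)) / a"
          and F'' = "\<gamma>\<^sup>2 * exp (\<gamma> * (1 - (norm (z - 0))\<^sup>2)) / a"]
        always_eventually allI height_has_derivative height_has_derivative2) auto
  show "\<forall>\<^sub>F w in nhds z. height \<gamma> c a ((norm (w - 0))\<^sup>2) \<le> ramp (height \<gamma> c a ((norm w)\<^sup>2))"
    using eventually_height[of "{..<0}" \<gamma> c a z] assms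
    by (auto elim!: eventually_mono simp: ramp_def)
qed (use assms in \<open>auto simp: ramp_def\<close>)

text \<open>The ramp is locally constant here, so no condition on \<open>\<gamma>\<close> or on the
  distance from the origin arises.\<close>

lemma laplacian_ramp_inside:
  fixes z :: "'a::euclidean_space"
  assumes "1 < height \<gamma> c a ((norm z)\<^sup>2)"
  shows "laplacian_ge (\<lambda>w. ramp (height \<gamma> c a ((norm w)\<^sup>2))) z 0"
proof (rule laplacian_ge_mono[OF laplacian_ge_const])
  show "\<forall>\<^sub>F w in nhds z. 1 / 2 \<le> ramp (height \<gamma> c a ((norm w)\<^sup>2))"
    using eventually_height[of "{1<..}" \<gamma> c a z] assms
    by (auto elim!: eventually_mono simp: ramp_def)
qed (use assms in \<open>auto simp: ramp_def\<close>)

text \<open>For a function h the Laplacian of h - h^2 / 2 is (1 - h) times that of h, minus the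
  squared gradient. The first part is nonnegative for h \<le> 1; the squared gradient is 4 q (h')^2,
  which gives the bound of order 1 / a^2.\<close>

lemma laplacian_ramp_shell:
  fixes z :: "'a::euclidean_space"
  assumes "0 < a" "0 < \<gamma>" "real DIM('a) \<le> 2 * \<gamma> * (norm z)\<^sup>2" "norm z \<le> 1"
    and h: "0 \<le> height \<gamma> c a ((norm z)\<^sup>2)" "height \<gamma> c a ((norm z)\<^sup>2) \<le> 1"
  shows "laplacian_ge (\<lambda>w. ramp (height \<gamma> c a ((norm w)\<^sup>2))) z (- (4 * \<gamma>\<^sup>2 * exp (2 * \<gamma>)) / a\<^sup>2)"
proof (rule laplacian_ge_mono)
  let ?h = "height \<gamma> c a" and ?h' = "\<lambda>t. - \<gamma> * exp (\<gamma> * (1 - t)) / a"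
    and ?h'' = "\<lambda>t. \<gamma>\<^sup>2 * exp (\<gamma> * (1 - t)) / a"
  define q where "q = (norm z)\<^sup>2"
  have q: "0 \<le> q" "q \<le> 1"
    using assms(4) by (auto simp: q_def power_le_one)
  show "laplacian_ge (\<lambda>w. ?h ((norm (w - 0))\<^sup>2) - (?h ((norm (w - 0))\<^sup>2))\<^sup>2 / 2) z
      (- (4 * \<gamma>\<^sup>2 * exp (2 * \<gamma>)) / a\<^sup>2)"
  proof (rule laplacian_ge_radial[where F = "\<lambda>t. ?h t - (?h t)\<^sup>2 / 2" and F' = "\<lambda>t. (1 - ?h t) * ?h' t"])
    show "\<forall>\<^sub>F t in nhds ((norm (z - 0))\<^sup>2).
        ((\<lambda>t. ?h t - (?h t)\<^sup>2 / 2) has_real_derivative (1 - ?h t) * ?h' t) (at t)"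
    proof (intro always_eventually allI)
      fix t
      from DERIV_diff[OF height_has_derivative DERIV_cdivide[OF DERIV_power[OF height_has_derivative, where n = 2], where c = 2]]
      show "((\<lambda>t. ?h t - (?h t)\<^sup>2 / 2) has_real_derivative (1 - ?h t) * ?h' t) (at t)"
        by (rule DERIV_cong) (simp add: algebra_simps diff_divide_distrib)
    qed
    show "((\<lambda>t. (1 - ?h t) * ?h' t) has_real_derivative
        (1 - ?h ((norm (z - 0))\<^sup>2)) * ?h'' ((norm (z - 0))\<^sup>2) - (?h' ((norm (z - 0))\<^sup>2))\<^sup>2) (at ((norm (z - 0))\<^sup>2))"
      by (rule DERIV_cong[OF DERIV_mult[OF DERIV_diff[OF DERIV_const height_has_derivative] height_has_derivative2]])
         (simp add: power2_eq_square algebra_simps)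
    have "q * (?h' q)\<^sup>2 \<le> 1 * (?h' q)\<^sup>2"
      using q by (intro mult_right_mono) auto
    also have "\<dots> = \<gamma>\<^sup>2 * exp (2 * (\<gamma> * (1 - q))) / a\<^sup>2"
      by (simp add: power_divide power_mult_distrib exp_double)
    also have "\<dots> \<le> \<gamma>\<^sup>2 * exp (2 * \<gamma>) / a\<^sup>2"
      using q assms by (intro divide_right_mono mult_left_mono) (auto simp: mult_left_le)
    finally have 1: "q * (?h' q)\<^sup>2 \<le> \<gamma>\<^sup>2 * exp (2 * \<gamma>) / a\<^sup>2" .
    have 2: "0 \<le> (1 - ?h q) * (2 * real DIM('a) * ?h' q + 4 * q * ?h'' q)"
      using height_laplacian_nonneg[OF assms(1-3)] h
      unfolding q_def by (intro mult_nonneg_nonneg) auto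
    have "2 * real DIM('a) * ((1 - ?h q) * ?h' q) + 4 * q * ((1 - ?h q) * ?h'' q - (?h' q)\<^sup>2)
       = (1 - ?h q) * (2 * real DIM('a) * ?h' q + 4 * q * ?h'' q) - 4 * (q * (?h' q)\<^sup>2)"
      by (simp only: algebra_simps)
    then show "- (4 * \<gamma>\<^sup>2 * exp (2 * \<gamma>)) / a\<^sup>2 \<le> 2 * real DIM('a) * ((1 - ?h ((norm (z - 0))\<^sup>2)) * ?h' ((norm (z - 0))\<^sup>2))
        + 4 * (norm (z - 0))\<^sup>2 * ((1 - ?h ((norm (z - 0))\<^sup>2)) * ?h'' ((norm (z - 0))\<^sup>2) - (?h' ((norm (z - 0))\<^sup>2))\<^sup>2)"
      using 1 2 unfolding q_def by simp
  qed
  show "\<forall>\<^sub>F w in nhds z. ?h ((norm (w - 0))\<^sup>2) - (?h ((norm (w - 0))\<^sup>2))\<^sup>2 / 2 \<le> ramp (?h ((norm w)\<^sup>2))"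
    by (simp add: ramp_ge_parabola)
qed (use h in \<open>auto simp: ramp_def\<close>)

subsection \<open>The barrier of a single layer\<close>

lemma exp_diff_ge:
  fixes x y :: real
  assumes "0 \<le> y" "y \<le> x"
  shows "x - y \<le> exp x - exp y"
proof -
  have "x - y \<le> exp y * (x - y)"
    using assms mult_right_mono[of 1 "exp y" "x - y"] by simp
  also have "\<dots> \<le> exp y * (exp (x - y) - 1)"
  proof (rule mult_left_mono)
    show "x - y \<le> exp (x - y) - 1"
      using exp_ge_add_one_self[of "x - y"] by linarith
  qed simp
  also have "\<dots> = exp x - exp y"
    by (simp add: right_diff_distrib flip: exp_add)
  finally show ?thesis .
qed

lemma exp_diff_le:
  fixes x y :: real
  shows "exp x - exp y \<le> exp x * (x - y)"
proof -
  have "exp x * (1 + (y - x)) \<le> exp x * exp (y - x)"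
    using exp_ge_add_one_self[of "y - x"] by (intro mult_left_mono) auto
  then show ?thesis
    by (simp add: algebra_simps flip: exp_add)
qed

text \<open>The denominator is what the bound \<open>barrier \<le> 1\<close> below requires, with \<open>\<gamma> = 8d\<close>.\<close>

definition hit_const :: "nat \<Rightarrow> real" where
  "hit_const d = 1 / (5 / 4 * (4 * (8 * real d)\<^sup>2 * exp (2 * (8 * real d))) + 1 / 2 +
     2 * (8 * real d) * exp (8 * real d))"

lemma hit_const_pos: "0 < hit_const d"
  unfolding hit_const_def by (intro divide_pos_pos add_nonneg_pos add_pos_nonneg) auto

text \<open>One layer in isolation: \<open>\<rho>\<close> is the bubble radius, \<open>R\<close> the
  norm of the centers and \<open>R + m * a\<close> the radius of the sphere on which the barrier is
  to vanish. The assumption \<open>capacity\<close> says that the bubbles are large enough: on their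
  surfaces the bump is at most of order 1 / \<open>\<alpha>\<close>.\<close>

locale layer =
  fixes X :: "'a::euclidean_space set" and a \<alpha> \<rho> R m :: real
  assumes dim: "2 \<le> DIM('a)"
    and X_finite: "finite X" and X_sphere: "X \<subseteq> sphere 0 R"
    and X_cover: "sphere 0 R \<subseteq> (\<Union>x\<in>X. ball x (a / 3))"
    and a_pos: "0 < a" and R_half: "1 / 2 < R" and outer_le: "R + m * a \<le> 1" and m_ge: "1 \<le> m"
    and \<alpha>_pos: "0 < \<alpha>" and \<alpha>m: "\<alpha> * m \<le> 1"
    and \<rho>_pos: "0 < \<rho>" and \<rho>_le: "\<rho> \<le> a"
    and capacity: "\<alpha> * (kern DIM('a) (\<rho>\<^sup>2 / a\<^sup>2) - kern DIM('a) 1) \<le> 5 / 4"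
begin

text \<open>With this \<open>\<gamma>\<close>, \<open>exp (\<gamma> (1 - \<bar>z\<bar>\<^sup>2))\<close> is subharmonic where \<open>\<bar>z\<bar> \<ge> 1 / 4\<close>; \<open>weight\<close> makes the
  Laplacian of the bump compensate the concave part of the ramp.\<close>

definition "\<gamma> = 8 * real DIM('a)"
definition "c = exp (\<gamma> * (1 - R\<^sup>2))"
definition "c' = exp (\<gamma> * (1 - (R + m * a)\<^sup>2))"
definition "weight = 4 * \<gamma>\<^sup>2 * exp (2 * \<gamma>)"

text \<open>The constant \<open>(c - c') / a\<close> is minus the height at norm
  \<open>R + m * a\<close>. It cancels the ramp on that sphere, and being at least \<open>m\<close>
  it alone provides the gain on the inner ball.\<close>

definition barrier :: "'a \<Rightarrow> real" where
  "barrier z = hit_const DIM('a) * \<alpha> *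
     (weight * bump X a z + (ramp (height \<gamma> c a ((norm z)\<^sup>2)) + (c - c') / a))"

lemma \<gamma>_ge: "16 \<le> \<gamma>"
  using dim by (simp add: \<gamma>_def)

lemma a_le: "a \<le> m * a" "a < 1 / 2" "R < 1"
proof -
  show "a \<le> m * a"
    using m_ge a_pos by simp
  then show "a < 1 / 2" "R < 1"
    using a_pos outer_le R_half by linarith+
qed

lemma weight_pos: "0 < weight"
  using \<gamma>_ge by (simp add: weight_def)

lemma X_nonempty: "X \<noteq> {}"
proof -
  obtain y :: 'a where "norm y = R"
    using vector_choose_size[of R] R_half by auto
  then have "y \<in> sphere 0 R" by simp
  then show ?thesis
    using X_cover by blast
qed

text \<open>Radial projection onto the sphere of centers moves z by at most a / 2, and the covering
  leads from there to a center within a / 3.\<close>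

lemma infdist_shell:
  assumes z: "R - a / 2 \<le> norm z" "norm z \<le> R"
  shows "infdist z X < a"
proof -
  have nz: "0 < norm z"
    using z R_half a_le by linarith
  define y where "y = (R / norm z) *\<^sub>R z"
  have "norm y = R"
    using nz R_half by (simp add: y_def)
  then obtain x where x: "x \<in> X" "dist x y < a / 3"
    using X_cover by (force simp: subset_iff)
  have "z - y = (1 - R / norm z) *\<^sub>R z"
    by (simp add: y_def algebra_simps)
  then have "norm (z - y) = \<bar>1 - R / norm z\<bar> * norm z"
    by simp
  also have "\<dots> = \<bar>(1 - R / norm z) * norm z\<bar>"
    by (simp add: abs_mult)
  also have "(1 - R / norm z) * norm z = norm z - R"
    using nz by (simp add: left_diff_distrib)
  also have "\<bar>norm z - R\<bar> \<le> a / 2"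
    using z by simp
  finally have "dist z y \<le> a / 2"
    by (simp add: dist_norm)
  have "infdist z X \<le> dist z x"
    by (rule infdist_le[OF x(1)])
  also have "\<dots> \<le> dist z y + dist x y"
    by (rule dist_triangle2)
  also have "\<dots> < a"
    using \<open>dist z y \<le> a / 2\<close> x(2) a_pos by linarith
  finally show ?thesis .
qed

text \<open>Since \<open>exp\<close> has slope at least 1 on nonnegative arguments, a height of at
  most 1 forces \<open>\<gamma>\<close> times the difference of the squared norms to be at most
  \<open>a\<close>. As \<open>\<gamma>\<close> is at least 16 and R + norm z at least 1 / 2, the
  norms differ by less than a / 2.\<close>

lemma height_shell:
  assumes z: "0 \<le> height \<gamma> c a ((norm z)\<^sup>2)" "height \<gamma> c a ((norm z)\<^sup>2) \<le> 1"
  shows "R - a / 2 \<le> norm z" "norm z \<le> R"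
proof -
  let ?q = "(norm z)\<^sup>2"
  have "exp (\<gamma> * (1 - R\<^sup>2)) \<le> exp (\<gamma> * (1 - ?q))"
    using z(1) a_pos by (simp add: height_def c_def zero_le_divide_iff)
  then have "?q \<le> R\<^sup>2"
    using \<gamma>_ge by simp
  then show le: "norm z \<le> R"
    by (rule power2_le_imp_le) (use R_half in simp)
  have R1: "R\<^sup>2 \<le> 1"
    using a_le R_half by (intro power_le_one) auto
  have "\<gamma> * (R\<^sup>2 - ?q) = \<gamma> * (1 - ?q) - \<gamma> * (1 - R\<^sup>2)"
    by (simp add: algebra_simps)
  also have "\<dots> \<le> exp (\<gamma> * (1 - ?q)) - exp (\<gamma> * (1 - R\<^sup>2))"
    using \<gamma>_ge \<open>?q \<le> R\<^sup>2\<close> R1 by (intro exp_diff_ge) auto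
  also have "\<dots> \<le> a"
    using z(2) a_pos by (simp add: height_def c_def divide_le_eq)
  finally have "\<gamma> * (R\<^sup>2 - ?q) \<le> a" .
  moreover have "16 * (R\<^sup>2 - ?q) \<le> \<gamma> * (R\<^sup>2 - ?q)"
    using \<gamma>_ge \<open>?q \<le> R\<^sup>2\<close> by (intro mult_right_mono) auto
  moreover have "(R - norm z) * (1 / 2) \<le> R\<^sup>2 - ?q"
  proof -
    have "(R - norm z) * (1 / 2) \<le> (R - norm z) * (R + norm z)"
      using le R_half by (intro mult_left_mono) (auto intro: add_increasing2)
    then show ?thesis
      by (simp add: power2_eq_square algebra_simps)
  qed
  ultimately show "R - a / 2 \<le> norm z"
    using a_pos by argo
qed

lemma laplacian_bump_nonneg:
  assumes "0 < infdist z X"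
  shows "laplacian_ge (bump X a) z 0"
proof (cases "a \<le> infdist z X")
  case True
  then show ?thesis
    using laplacian_bump_far dim a_pos by blast
next
  case False
  then have "laplacian_ge (bump X a) z (real DIM('a) / (2 * a\<^sup>2))"
    using assms dim a_pos X_finite X_nonempty by (intro laplacian_bump_near) auto
  then show ?thesis
    by (rule laplacian_ge_mono) auto
qed

text \<open>Both summands are harmless where the height is below 0 or above 1. In between, the ramp
  costs \<open>weight / a\<^sup>2\<close>; there some center is closer than \<open>a\<close>, and
  the bump pays back \<open>weight\<close> times d / (2 a^2), which suffices for d \<ge> 2.\<close>

lemma laplacian_barrier:
  assumes z: "norm z \<le> 1" "0 < infdist z X"
  shows "laplacian_ge barrier z 0"
proof -
  let ?h = "height \<gamma> c a ((norm z)\<^sup>2)"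
  have \<gamma>: "0 < \<gamma>"
    using \<gamma>_ge by simp
  have big: "real DIM('a) \<le> 2 * \<gamma> * (norm z)\<^sup>2" if "1 / 4 \<le> norm z"
  proof -
    have "(1 / 4)\<^sup>2 \<le> (norm z)\<^sup>2"
      using that by (intro power_mono) auto
    then have "2 * \<gamma> * (1 / 4)\<^sup>2 \<le> 2 * \<gamma> * (norm z)\<^sup>2"
      using \<gamma> by (intro mult_left_mono) auto
    then show ?thesis
      by (simp add: \<gamma>_def power2_eq_square)
  qed
  have w: "laplacian_ge (\<lambda>w. weight * bump X a w) z 0"
    using laplacian_bump_nonneg[OF z(2)] weight_pos by (intro laplacian_ge_cmult) auto
  consider "?h < 0" | "1 < ?h" | "0 \<le> ?h" "?h \<le> 1" by linarith
  then have "laplacian_ge (\<lambda>w. weight * bump X a w + ramp (height \<gamma> c a ((norm w)\<^sup>2))) z 0"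
  proof cases
    case 1
    then have "exp (\<gamma> * (1 - (norm z)\<^sup>2)) < exp (\<gamma> * (1 - R\<^sup>2))"
      using a_pos by (simp add: height_def c_def divide_less_0_iff)
    then have "R\<^sup>2 < (norm z)\<^sup>2"
      using \<gamma> by simp
    then have "R < norm z"
      by (rule power2_less_imp_less) simp
    then show ?thesis
      using 1 w big R_half a_pos \<gamma> by (intro laplacian_ge_add[OF w laplacian_ramp_outside]) auto
  next
    case 2
    then show ?thesis
      by (intro laplacian_ge_add[OF w laplacian_ramp_inside]) auto
  next
    case 3
    note s = height_shell[OF 3]
    have "laplacian_ge (bump X a) z (real DIM('a) / (2 * a\<^sup>2))"
      using z dim a_pos X_finite X_nonempty infdist_shell[OF s] by (intro laplacian_bump_near) auto
    then have "laplacian_ge (\<lambda>w. weight * bump X a w) z (weight / a\<^sup>2)"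
    proof (rule laplacian_ge_cmult)
      have "weight / a\<^sup>2 * 1 \<le> weight / a\<^sup>2 * (real DIM('a) / 2)"
        using weight_pos dim by (intro mult_left_mono) auto
      then show "weight / a\<^sup>2 \<le> weight * (real DIM('a) / (2 * a\<^sup>2))"
        by simp
    qed (use weight_pos in simp)
    moreover have "1 / 4 \<le> norm z"
      using s R_half a_le by linarith
    then have "laplacian_ge (\<lambda>w. ramp (height \<gamma> c a ((norm w)\<^sup>2))) z (- (4 * \<gamma>\<^sup>2 * exp (2 * \<gamma>)) / a\<^sup>2)"
      using a_pos \<gamma> big z 3 by (intro laplacian_ramp_shell) auto
    ultimately show ?thesis
      by (rule laplacian_ge_add) (simp add: weight_def)
  qed
  then have "laplacian_ge (\<lambda>w. (weight * bump X a w + ramp (height \<gamma> c a ((norm w)\<^sup>2))) + (c - c') / a) z 0"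
    by (rule laplacian_ge_add[OF _ laplacian_ge_const]) simp
  then show ?thesis
    unfolding barrier_def[abs_def] using \<alpha>_pos hit_const_pos[of "DIM('a)"]
    by (intro laplacian_ge_cmult[where a = 0]) (auto simp: add.assoc)
qed

lemma continuous_on_barrier:
  assumes "\<And>z. z \<in> S \<Longrightarrow> 0 < infdist z X"
  shows "continuous_on S barrier"
proof -
  have "continuous_on S (\<lambda>z. height \<gamma> c a ((norm z)\<^sup>2))"
    unfolding height_def using a_pos by (intro continuous_intros) auto
  then have "continuous_on S (\<lambda>z. ramp (height \<gamma> c a ((norm z)\<^sup>2)))"
    by (rule continuous_on_compose2[OF continuous_on_ramp[of UNIV]]) auto
  then show ?thesis
    unfolding barrier_def[abs_def] using continuous_on_bump[OF dim a_pos assms]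
    by (intro continuous_on_mult continuous_on_add continuous_on_const) auto
qed

section \<open>Size of the barrier on the bubbles and on the bounding spheres\<close>

lemma outer_gap: "m * a \<le> (R + m * a)\<^sup>2 - R\<^sup>2" "(R + m * a)\<^sup>2 - R\<^sup>2 \<le> 2 * (m * a)"
proof -
  have eq: "(R + m * a)\<^sup>2 - R\<^sup>2 = m * a * (2 * R + m * a)"
    by (simp add: power2_eq_square algebra_simps)
  have ma: "0 \<le> m * a"
    using a_pos m_ge by simp
  show "m * a \<le> (R + m * a)\<^sup>2 - R\<^sup>2"
    unfolding eq using ma R_half mult_left_mono[of 1 "2 * R + m * a" "m * a"] by simp
  show "(R + m * a)\<^sup>2 - R\<^sup>2 \<le> 2 * (m * a)"
    unfolding eq using ma outer_le a_le mult_left_mono[of "2 * R + m * a" 2 "m * a"] by simp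
qed

text \<open>The squared norms of the two spheres differ by an amount between \<open>m * a\<close>
  and \<open>2 * (m * a)\<close>, and on bounded arguments \<open>exp\<close> distorts differences
  only by a bounded factor.\<close>

lemma c_diff: "m \<le> (c - c') / a" "(c - c') / a \<le> 2 * \<gamma> * exp \<gamma> * m"
proof -
  let ?D = "(R + m * a)\<^sup>2 - R\<^sup>2"
  have \<gamma>: "1 \<le> \<gamma>"
    using \<gamma>_ge by simp
  have R1: "(R + m * a)\<^sup>2 \<le> 1"
    using a_le R_half outer_le a_pos by (intro power_le_one) auto
  have ma: "0 \<le> m * a"
    using a_pos m_ge by simp
  have D: "\<gamma> * (1 - R\<^sup>2) - \<gamma> * (1 - (R + m * a)\<^sup>2) = \<gamma> * ?D"
    by (simp add: algebra_simps)
  have "m * a \<le> \<gamma> * (m * a)"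
    using \<gamma> ma mult_right_mono[of 1 \<gamma> "m * a"] by simp
  also have "\<dots> \<le> \<gamma> * ?D"
    using outer_gap \<gamma> by (intro mult_left_mono) auto
  also have "\<dots> \<le> c - c'"
    unfolding c_def c'_def D[symmetric] using \<gamma> R1 outer_gap ma by (intro exp_diff_ge) auto
  finally show "m \<le> (c - c') / a"
    using a_pos by (simp add: pos_le_divide_eq)
  have "c - c' \<le> c * (\<gamma> * ?D)"
    unfolding c_def c'_def D[symmetric] by (rule exp_diff_le)
  also have "\<dots> \<le> exp \<gamma> * (\<gamma> * (2 * (m * a)))"
    using \<gamma> outer_gap ma unfolding c_def
    by (intro mult_mono) (auto simp: mult_left_le)
  finally show "(c - c') / a \<le> 2 * \<gamma> * exp \<gamma> * m"
    using a_pos by (simp add: pos_divide_le_eq ac_simps)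
qed

text \<open>After multiplication by \<open>\<alpha>\<close> each summand is bounded in terms of the
  dimension alone: the bump by \<open>capacity\<close>, the ramp by \<open>\<alpha> \<le> 1\<close>,
  the constant by \<open>\<alpha>m\<close>. The reciprocal of the total is
  \<open>hit_const\<close>.\<close>

lemma barrier_le_one:
  assumes z: "\<rho> \<le> infdist z X"
  shows "barrier z \<le> 1"
proof -
  have "\<alpha> * bump X a z \<le> \<alpha> * (kern DIM('a) (\<rho>\<^sup>2 / a\<^sup>2) - kern DIM('a) 1)"
    using bump_le[OF dim \<rho>_pos z \<rho>_le] \<alpha>_pos by (intro mult_left_mono) auto
  then have "weight * (\<alpha> * bump X a z) \<le> weight * (5 / 4)"
    using capacity weight_pos by (intro mult_left_mono) auto
  moreover have "\<alpha> * ramp (height \<gamma> c a ((norm z)\<^sup>2)) \<le> 1 * (1 / 2)"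
  proof -
    have "\<alpha> \<le> \<alpha> * m"
      using \<alpha>_pos m_ge by simp
    then have "\<alpha> \<le> 1"
      using \<alpha>m by linarith
    have "\<alpha> * ramp (height \<gamma> c a ((norm z)\<^sup>2)) \<le> \<alpha> * (1 / 2)"
      using \<alpha>_pos ramp_le_half by (intro mult_left_mono) auto
    then show ?thesis
      using \<open>\<alpha> \<le> 1\<close> by simp
  qed
  moreover have "\<alpha> * ((c - c') / a) \<le> 2 * \<gamma> * exp \<gamma>"
  proof -
    have "\<alpha> * ((c - c') / a) \<le> \<alpha> * (2 * \<gamma> * exp \<gamma> * m)"
      using c_diff \<alpha>_pos by (intro mult_left_mono) auto
    also have "\<dots> = 2 * \<gamma> * exp \<gamma> * (\<alpha> * m)"
      by (simp add: ac_simps)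
    also have "\<dots> \<le> 2 * \<gamma> * exp \<gamma> * 1"
      using \<gamma>_ge \<alpha>m by (intro mult_left_mono) auto
    finally show ?thesis by simp
  qed
  ultimately have "\<alpha> * (weight * bump X a z + (ramp (height \<gamma> c a ((norm z)\<^sup>2)) + (c - c') / a))
      \<le> weight * (5 / 4) + 1 / 2 + 2 * \<gamma> * exp \<gamma>"
    by (simp add: algebra_simps)
  also have "\<dots> = 1 / hit_const DIM('a)"
    by (simp add: hit_const_def weight_def \<gamma>_def)
  finally show ?thesis
    using hit_const_pos[of "DIM('a)"] by (simp add: barrier_def field_simps)
qed

text \<open>This sphere is at distance \<open>m * a\<close>, hence at least \<open>a\<close>, from
  the centers, so the bump is 0; the height is negative there, so the ramp is the identity and the
  constant cancels it.\<close>

lemma barrier_outer: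
  assumes z: "norm z = R + m * a"
  shows "barrier z = 0"
proof -
  obtain x where x: "x \<in> X" "infdist z X = dist z x"
    using infdist_attains_inf[OF finite_imp_closed[OF X_finite] X_nonempty] by blast
  have "norm x = R"
    using x X_sphere by auto
  then have "a \<le> infdist z X"
    using x z a_le norm_triangle_ineq2[of z x] by (simp add: dist_norm)
  then have "bump X a z = 0"
    using a_pos by (intro bump_far)
  moreover have "height \<gamma> c a ((norm z)\<^sup>2) = - ((c - c') / a)"
    by (simp add: z height_def c'_def minus_divide_left)
  ultimately show ?thesis
    using c_diff(1) m_ge by (simp add: barrier_def ramp_def)
qed

lemma barrier_inner:
  assumes z: "norm z \<le> R" "0 < infdist z X"
  shows "hit_const DIM('a) * \<alpha> * m \<le> barrier z"
proof -
  have "(norm z)\<^sup>2 \<le> R\<^sup>2"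
    using z by (intro power_mono) auto
  then have "0 \<le> height \<gamma> c a ((norm z)\<^sup>2)"
    using a_pos \<gamma>_ge by (simp add: height_def c_def)
  then have "m \<le> weight * bump X a z + (ramp (height \<gamma> c a ((norm z)\<^sup>2)) + (c - c') / a)"
    using c_diff(1) ramp_nonneg bump_nonneg[OF dim a_pos z(2)] weight_pos
    by (smt (verit) mult_nonneg_nonneg)
  then show ?thesis
    unfolding barrier_def using hit_const_pos[of "DIM('a)"] \<alpha>_pos by (intro mult_left_mono) auto
qed

text \<open>Inside the outer ball u is compared with \<open>1 - M * (1 - barrier z)\<close>. On the
  boundary of V this is at most 1 because the barrier is; on the outer sphere it equals 1 - M
  because the barrier vanishes. On the inner ball the barrier shrinks the deficit by a
  factor.\<close>

lemma deficit_decrease: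
  assumes V: "open V" "\<And>z. z \<in> V \<Longrightarrow> \<rho> \<le> infdist z X"
    and u: "superharmonic_on V u" "bdd_below (u ` V)"
    and bdry: "\<And>\<zeta>. \<zeta> \<in> frontier V \<Longrightarrow> norm \<zeta> < R + m * a \<Longrightarrow>
      1 \<le> Liminf (at \<zeta> within V) (\<lambda>z. ereal (u z))"
    and M: "0 \<le> M" "\<And>z. z \<in> V \<Longrightarrow> norm z < R + m * a \<Longrightarrow> 1 - M \<le> u z"
    and z: "z \<in> V" "norm z \<le> R"
  shows "1 - M * (1 - hit_const DIM('a) * \<alpha> * m) \<le> u z"
proof -
  define W where "W = V \<inter> ball 0 (R + m * a)"
  have ma: "0 < m * a"
    using a_pos m_ge by simp
  have zW: "z \<in> W"
    using z ma by (simp add: W_def)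
  have "closed {z. \<rho> \<le> infdist z X}"
    by (intro closed_Collect_le continuous_intros)
  \<comment> \<open>The distance bound must reach the closure, since the barrier has to be
    continuous and at most 1 on the boundary too.\<close>
  then have "closure V \<subseteq> {z. \<rho> \<le> infdist z X}"
    using V(2) by (intro closure_minimal) auto
  moreover have "closure W \<subseteq> closure V"
    unfolding W_def by (intro closure_mono) auto
  ultimately have infW: "\<rho> \<le> infdist \<zeta> X" if "\<zeta> \<in> closure W" for \<zeta>
    using that by blast
  have "closure W \<subseteq> cball 0 (R + m * a)"
    unfolding W_def by (intro closure_minimal) auto
  then have normW: "norm \<zeta> \<le> R + m * a" if "\<zeta> \<in> closure W" for \<zeta>
    using that by auto
  \<comment> \<open>The term with \<open>\<epsilon>\<close> makes the comparison function strictly subharmonic.\<close>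
  have main: "1 - M * (1 - barrier z) + \<epsilon> * ((norm z)\<^sup>2 - 1) \<le> u z" if \<epsilon>: "\<epsilon> > 0" for \<epsilon>
  proof (rule superharmonic_on_comparison[of W u "\<lambda>z. 1 - M * (1 - barrier z) + \<epsilon> * ((norm z)\<^sup>2 - 1)"])
    show "superharmonic_on W u"
      using u(1) by (rule superharmonic_on_subset) (simp add: W_def)
    show "bdd_below (u ` W)"
      using u(2) by (rule bdd_below_mono) (auto simp: W_def)
    show "open W"
      using V by (simp add: W_def open_Int)
    show "bounded W"
      unfolding W_def by (simp add: bounded_Int)
    show "continuous_on (closure W) (\<lambda>z. 1 - M * (1 - barrier z) + \<epsilon> * ((norm z)\<^sup>2 - 1))"
      using infW \<rho>_pos by (intro continuous_intros continuous_on_barrier) (meson less_le_trans)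
    show "\<exists>\<Lambda>>0. laplacian_ge (\<lambda>z. 1 - M * (1 - barrier z) + \<epsilon> * ((norm z)\<^sup>2 - 1)) w \<Lambda>" if w: "w \<in> W" for w
    proof (intro exI conjI)
      have "laplacian_ge barrier w 0"
        using w V(2)[of w] \<rho>_pos outer_le by (intro laplacian_barrier) (auto simp: W_def)
      then have "laplacian_ge (\<lambda>z. M * barrier z) w 0"
        using M(1) by (intro laplacian_ge_cmult) auto
      moreover have "laplacian_ge (\<lambda>z. (norm (z - 0))\<^sup>2) w (2 * real DIM('a) * 1 + 4 * (norm (w - 0))\<^sup>2 * 0)"
        by (rule laplacian_ge_radial[where F = "\<lambda>t. t" and F' = "\<lambda>t. 1" and F'' = 0]) auto
      then have "laplacian_ge (\<lambda>z. \<epsilon> * (norm z)\<^sup>2) w (\<epsilon> * (2 * real DIM('a)))"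
        using \<epsilon> by (intro laplacian_ge_cmult) auto
      ultimately have "laplacian_ge (\<lambda>z. (M * barrier z + \<epsilon> * (norm z)\<^sup>2) + (1 - M - \<epsilon>)) w (\<epsilon> * (2 * real DIM('a)))"
        by (intro laplacian_ge_add[OF laplacian_ge_add laplacian_ge_const]) auto
      then show "laplacian_ge (\<lambda>z. 1 - M * (1 - barrier z) + \<epsilon> * ((norm z)\<^sup>2 - 1)) w (\<epsilon> * (2 * real DIM('a)))"
        by (simp add: algebra_simps)
      show "0 < \<epsilon> * (2 * real DIM('a))"
        using \<epsilon> by simp
    qed
    show "ereal (1 - M * (1 - barrier \<zeta>) + \<epsilon> * ((norm \<zeta>)\<^sup>2 - 1)) \<le> Liminf (at \<zeta> within W) (\<lambda>z. ereal (u z))"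
      if \<zeta>: "\<zeta> \<in> frontier W" for \<zeta>
    proof -
      have cl: "\<zeta> \<in> closure W" and nW: "\<zeta> \<notin> W"
        using \<zeta> \<open>open W\<close> by (auto simp: frontier_def interior_open)
      have "(norm \<zeta>)\<^sup>2 \<le> 1"
        using normW[OF cl] outer_le by (intro power_le_one) auto
      then have \<epsilon>_le: "\<epsilon> * ((norm \<zeta>)\<^sup>2 - 1) \<le> 0"
        using \<epsilon> by (simp add: mult_nonneg_nonpos)
      show ?thesis
      \<comment> \<open>A boundary point of \<open>W\<close> inside the outer ball is a boundary
        point of V; any other lies on the outer sphere.\<close>
      proof (cases "norm \<zeta> < R + m * a")
        case True
        then have "\<zeta> \<in> frontier V"
          using cl nW V(1) \<open>closure W \<subseteq> closure V\<close> by (auto simp: W_def frontier_def interior_open)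
        have "0 \<le> M * (1 - barrier \<zeta>)"
          using M(1) barrier_le_one[OF infW[OF cl]] by simp
        then have "ereal (1 - M * (1 - barrier \<zeta>) + \<epsilon> * ((norm \<zeta>)\<^sup>2 - 1)) \<le> 1"
          using \<epsilon>_le by simp
        also have "\<dots> \<le> Liminf (at \<zeta> within V) (\<lambda>z. ereal (u z))"
          by (rule bdry[OF \<open>\<zeta> \<in> frontier V\<close> True])
        also have "\<dots> \<le> Liminf (at \<zeta> within W) (\<lambda>z. ereal (u z))"
          unfolding le_Liminf_iff
          using filter_leD[OF at_le[of W V \<zeta>]] less_LiminfD by (force simp: W_def)
        finally show ?thesis .
      next
        case False
        then have "barrier \<zeta> = 0"
          using normW[OF cl] by (intro barrier_outer) simp
        then have le: "1 - M * (1 - barrier \<zeta>) + \<epsilon> * ((norm \<zeta>)\<^sup>2 - 1) \<le> 1 - M"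
          using \<epsilon>_le by simp
        have "\<forall>w\<in>W. 1 - M \<le> u w"
          using M(2) by (auto simp: W_def)
        then have "\<forall>\<^sub>F w in at \<zeta> within W. 1 - M \<le> u w"
          by (auto simp: eventually_at_filter)
        then show ?thesis
          using le by (intro Liminf_bounded) (auto elim!: eventually_mono)
      qed
    qed
  qed (rule zW)
  have "1 - M * (1 - hit_const DIM('a) * \<alpha> * m) \<le> u z + \<epsilon>" if \<epsilon>: "\<epsilon> > 0" for \<epsilon>
  proof -
    have "M * (hit_const DIM('a) * \<alpha> * m) \<le> M * barrier z"
      using M(1) z V(2)[of z] \<rho>_pos by (intro mult_left_mono barrier_inner) auto
    moreover have "- \<epsilon> \<le> \<epsilon> * ((norm z)\<^sup>2 - 1)"
      using \<epsilon> by (simp add: algebra_simps)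
    ultimately show ?thesis
      using main[OF \<epsilon>] by (simp add: algebra_simps)
  qed
  then show ?thesis
    by (rule field_le_epsilon)
qed

end

subsection \<open>Series, capacities and counting\<close>

text \<open>The radius is chosen so that the fundamental solution at \<open>\<rho> / a\<close> is at
  most \<open>1 / \<alpha>\<close>: for d = 2 it is \<open>1 / \<alpha> + ln a\<close>, and for d
  \<ge> 3 the powers cancel to \<open>1 / \<alpha>\<close> divided by d - 2. The quadratic term adds
  at most 1 / 4.\<close>

lemma capacity_bound:
  fixes a \<alpha> \<rho> :: real
  assumes d: "2 \<le> d" and \<alpha>: "0 < \<alpha>" "\<alpha> \<le> 1" and a: "0 < a" "a \<le> 1"
    and \<rho>: "\<rho> = (if d = 2 then exp (- inverse \<alpha>) else a * \<alpha> powr (1 / (real d - 2)))"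
    and le: "\<rho> \<le> a"
  shows "\<alpha> * (kern d (\<rho>\<^sup>2 / a\<^sup>2) - kern d 1) \<le> 5 / 4"
proof -
  have \<rho>0: "0 < \<rho>"
    using \<alpha> a by (simp add: \<rho>)
  then have s1: "\<rho>\<^sup>2 / a\<^sup>2 \<le> 1"
    using le a by (simp add: divide_le_eq power_mono)
  have "kern d (\<rho>\<^sup>2 / a\<^sup>2) \<le> 1 / \<alpha> + 1 / 4"
  proof (cases "d = 2")
    case True
    have "ln (\<rho>\<^sup>2 / a\<^sup>2) = 2 * ln \<rho> - 2 * ln a"
      using \<rho>0 a by (simp add: ln_div ln_realpow)
    also have "ln \<rho> = - inverse \<alpha>"
      using True by (simp add: \<rho>)
    finally have "- ln (\<rho>\<^sup>2 / a\<^sup>2) / 2 = 1 / \<alpha> + ln a"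
      by (simp add: inverse_eq_divide)
    moreover have "ln a \<le> 0"
      using a by simp
    ultimately show ?thesis
      using True s1 by (simp add: kern_def)
  next
    case False
    then have d3: "1 \<le> real d - 2"
      using d by linarith
    have "\<rho>\<^sup>2 / a\<^sup>2 = (\<alpha> powr (1 / (real d - 2)))\<^sup>2"
      using False a by (simp add: \<rho> power_mult_distrib)
    also have "\<dots> = \<alpha> powr (2 / (real d - 2))"
      using \<alpha> by (simp add: powr_power)
    finally have "(\<rho>\<^sup>2 / a\<^sup>2) powr (- (real d - 2) / 2) = \<alpha> powr (2 / (real d - 2) * (- (real d - 2) / 2))"
      by (simp add: powr_powr)
    also have "2 / (real d - 2) * (- (real d - 2) / 2) = - 1"
      using d3 by (simp add: field_simps)
    also have "\<alpha> powr - 1 = 1 / \<alpha>"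
      using \<alpha> by (simp add: powr_minus_divide)
    finally have "(\<rho>\<^sup>2 / a\<^sup>2) powr (- (real d - 2) / 2) / (real d - 2) \<le> 1 / \<alpha>"
      using d3 \<alpha> by (simp add: divide_le_eq)
    then show ?thesis
      using False s1 unfolding kern_def by simp
  qed
  then have "kern d (\<rho>\<^sup>2 / a\<^sup>2) - kern d 1 \<le> 1 / \<alpha> + 1 / 4"
    using kern_one_nonneg[OF d] by simp
  then have "\<alpha> * (kern d (\<rho>\<^sup>2 / a\<^sup>2) - kern d 1) \<le> \<alpha> * (1 / \<alpha> + 1 / 4)"
    using \<alpha> by (intro mult_left_mono) auto
  also have "\<dots> \<le> 5 / 4"
    using \<alpha> by (simp add: distrib_left)
  finally show ?thesis .
qed

text \<open>Together with \<open>\<alpha> k * m k \<le> 1\<close> this keeps the factors by which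
  deficits shrink nonnegative.\<close>

lemma hit_const_le_one: "1 \<le> d \<Longrightarrow> hit_const d \<le> 1"
proof -
  assume d: "1 \<le> d"
  have "1 * 1 \<le> 2 * (8 * real d) * exp (8 * real d)"
    using d by (intro mult_mono) auto
  then have "1 \<le> 5 / 4 * (4 * (8 * real d)\<^sup>2 * exp (2 * (8 * real d))) + 1 / 2 + 2 * (8 * real d) * exp (8 * real d)"
    by (smt (verit) mult_nonneg_nonneg zero_le_power2 exp_ge_zero divide_nonneg_nonneg)
  then show ?thesis
    by (simp add: hit_const_def)
qed

section \<open>Tails of series with nonnegative terms\<close>

lemma infsum_atLeast_split:
  fixes g :: "nat \<Rightarrow> real"
  assumes "g summable_on {k..}" "k \<le> n"
  shows "infsum g {k..} = sum g {k..<n} + infsum g {n..}"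
proof -
  have "{k..} = {k..<n} \<union> {n..}"
    using assms(2) by auto
  then show ?thesis
    using infsum_Un_disjoint[of g "{k..<n}" "{n..}"] summable_on_subset_banach[OF assms(1), of "{n..}"] assms(2)
    by (auto simp: Int_def)
qed

lemma summable_on_tail_small:
  fixes g :: "nat \<Rightarrow> real"
  assumes g: "g summable_on {k..}" and nonneg: "\<And>j. j \<ge> k \<Longrightarrow> 0 \<le> g j" and e: "0 < e"
  shows "\<exists>n\<ge>k. infsum g {n..} < e"
proof -
  obtain F where F: "finite F" "F \<subseteq> {k..}" "dist (sum g F) (infsum g {k..}) \<le> e / 2"
    using infsum_finite_approximation[OF g, of "e / 2"] e by auto
  \<comment> \<open>Inserting \<open>k\<close> keeps the maximum meaningful for empty
    \<open>F\<close> and ensures k \<le> n.\<close>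
  define n where "n = Suc (Max (insert k F))"
  have "j < n" if "j \<in> insert k F" for j
    using Max_ge[of "insert k F" j] that F(1) by (auto simp: n_def less_Suc_eq_le simp del: Max_insert)
  then have n: "k \<le> n" "F \<subseteq> {k..<n}"
    using F by (auto intro: less_imp_le)
  have "sum g F \<le> sum g {k..<n}"
    using n nonneg by (intro sum_mono2) auto
  then have "infsum g {n..} < e"
    using infsum_atLeast_split[OF g n(1)] F(3)[unfolded dist_real_def] e by linarith
  then show ?thesis
    using n(1) by blast
qed

lemma not_summable_on_unbounded:
  fixes g :: "nat \<Rightarrow> real"
  assumes g: "\<not> g summable_on {k..}" and nonneg: "\<And>j. j \<ge> k \<Longrightarrow> 0 \<le> g j" and "k \<le> n"
  shows "\<exists>l. C < sum g {n..<n + l}"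
proof (rule ccontr)
  assume "\<not> ?thesis"
  then have C: "\<And>l. sum g {n..<n + l} \<le> C"
    by (simp add: not_less)
  have "g summable_on {n..}"
  proof (rule nonneg_bdd_above_summable_on)
    show "bdd_above (sum g ` {F. F \<subseteq> {n..} \<and> finite F})"
    proof (rule bdd_aboveI, clarify)
      fix F assume F: "F \<subseteq> {n..}" "finite F"
      have "j < n + Suc (Max (insert n F))" if "j \<in> F" for j
        using Max_ge[of "insert n F" j] that F(2)
        by (auto simp: less_Suc_eq_le intro: trans_le_add2 simp del: Max_insert)
      then have "F \<subseteq> {n..<n + Suc (Max (insert n F))}"
        using F by auto
      then have "sum g F \<le> sum g {n..<n + Suc (Max (insert n F))}"
        using nonneg assms(3) by (intro sum_mono2) auto
      then show "sum g F \<le> C"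
        using C order.trans by blast
    qed
  qed (use nonneg assms(3) in auto)
  moreover have "{k..} = {k..<n} \<union> {n..}" "{k..<n} \<inter> {n..} = {}"
    using assms(3) by auto
  ultimately have "g summable_on {k..}"
    using summable_on_Un_disjoint[of g "{k..<n}" "{n..}"] by auto
  then show False
    using g by simp
qed

section \<open>Counting separated points on a sphere\<close>

lemma power_diff_le:
  fixes x y :: real
  assumes "0 \<le> y" "y \<le> x"
  shows "x ^ n - y ^ n \<le> real n * x ^ (n - 1) * (x - y)"
proof (cases n)
  case (Suc l)
  have "x ^ n - y ^ n = (x - y) * (\<Sum>i<n. x ^ i * y ^ (l - i))"
    using power_diff_sumr2[of x n y] Suc by (simp add: ac_simps lessThan_Suc_atMost)
  also have "\<dots> \<le> (x - y) * (\<Sum>i<n. x ^ l)"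
  proof (intro mult_left_mono sum_mono)
    fix i assume "i \<in> {..<n}"
    then have "x ^ l = x ^ i * x ^ (l - i)"
      using Suc by (simp flip: power_add)
    moreover have "x ^ i * y ^ (l - i) \<le> x ^ i * x ^ (l - i)"
      using assms by (intro mult_left_mono power_mono) auto
    ultimately show "x ^ i * y ^ (l - i) \<le> x ^ l" by simp
  qed (use assms in simp)
  finally show ?thesis
    using Suc by (simp add: ac_simps)
qed simp

text \<open>The disjoint balls lie in a shell of thickness 2 s, whose volume is at most 2 d s times
  that of the unit ball. That volume and one factor s cancel.\<close>

lemma card_separated_sphere_le:
  fixes X :: "'a::euclidean_space set"
  assumes X: "finite X" "X \<subseteq> sphere 0 R" and disj: "disjoint_family_on (\<lambda>x. ball x s) X"
    and s: "0 < s" "s \<le> R" "R + s \<le> 1"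
  shows "real (card X) * s ^ (DIM('a) - 1) \<le> 2 * DIM('a)"
proof -
  let ?d = "DIM('a)" and ?w = "unit_ball_vol (real DIM('a))"
  have fin: "emeasure lborel (ball y t) \<noteq> \<infinity>" for y :: 'a and t
    using emeasure_lborel_ball_finite[of y t] by (simp add: less_top)
  have sub: "(\<Union>x\<in>X. ball x s) \<subseteq> ball 0 (R + s) - ball 0 (R - s)"
  proof
    fix z assume "z \<in> (\<Union>x\<in>X. ball x s)"
    then obtain x where x: "x \<in> X" "dist x z < s" by auto
    then have "norm x = R"
      using X by auto
    then show "z \<in> ball 0 (R + s) - ball 0 (R - s)"
      using x norm_triangle_ineq2[of x z] norm_triangle_ineq2[of z x]
      by (auto simp: dist_norm norm_minus_commute)
  qed
  have "real (card X) * (?w * s ^ ?d) = (\<Sum>x\<in>X. measure lborel (ball x s))"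
    using s by (simp add: content_ball)
  also have "\<dots> = measure lborel (\<Union>x\<in>X. ball x s)"
    using X disj by (intro measure_finite_Union[symmetric]) (auto simp: fin[simplified])
  also have "\<dots> \<le> measure lborel (ball (0::'a) (R + s) - ball 0 (R - s))"
  proof (rule measure_mono_fmeasurable[OF sub])
    show "ball (0::'a) (R + s) - ball 0 (R - s) \<in> fmeasurable lborel"
      using fin by (intro fmeasurable.Diff fmeasurableI) (auto simp: less_top)
  qed (use X in auto)
  also have "\<dots> = measure lborel (ball (0::'a) (R + s)) - measure lborel (ball (0::'a) (R - s))"
    using s by (intro measure_Diff) (auto simp: fin[simplified])
  also have "\<dots> = ?w * ((R + s) ^ ?d - (R - s) ^ ?d)"
    using s by (simp add: content_ball algebra_simps)
  finally have "real (card X) * s ^ ?d \<le> (R + s) ^ ?d - (R - s) ^ ?d"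
    by (simp add: mult.left_commute)
  also have "\<dots> \<le> real ?d * (R + s) ^ (?d - 1) * ((R + s) - (R - s))"
    using s by (intro power_diff_le) auto
  also have "\<dots> \<le> real ?d * 1 * ((R + s) - (R - s))"
    using s by (intro mult_right_mono mult_left_mono power_le_one) auto
  also have "s ^ ?d = s ^ (?d - 1) * s"
    by (simp flip: power_Suc2)
  finally have "(real (card X) * s ^ (?d - 1)) * s \<le> (2 * ?d) * s"
    by (simp add: ac_simps)
  then show ?thesis
    using s by simp
qed

lemma superharmonic_on_const: "superharmonic_on V (\<lambda>z. c)"
  unfolding superharmonic_on_def
proof (intro conjI ballI allI impI)
  fix x :: 'a and r :: real
  assume r: "0 < r \<and> cball x r \<subseteq> V"
  show "set_integrable lborel (cball x r) (\<lambda>z. c)"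
    by (intro set_integrable_cball_continuous continuous_intros)
  have "measure lborel (cball x r) > 0"
    using r by simp
  then show "(LINT z:cball x r|lborel. c) / measure lborel (cball x r) \<le> c"
    using r by (simp add: set_lebesgue_integral_def emeasure_cball)
qed (simp add: Liminf_bounded)

subsection \<open>Layers of bubbles\<close>

locale bubble_layers =
  fixes k0 k1 k2 :: nat
    and m :: "nat \<Rightarrow> nat"
    and \<alpha> \<beta> a R \<rho> :: "nat \<Rightarrow> real"
    and X :: "nat \<Rightarrow> 'a::euclidean_space set"
    and r :: "'a \<Rightarrow> real"
    and f :: "real \<Rightarrow> real"
  assumes dim: "DIM('a) \<ge> 2"
    and pos: "\<And>k. k \<ge> k0 \<Longrightarrow> 0 < m k \<and> 0 < \<alpha> k \<and> 0 < \<beta> k"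
    and mono: "\<And>k. k \<ge> k0 \<Longrightarrow> m k \<le> m (k + 1) \<and> \<alpha> (k + 1) \<le> \<alpha> k \<and> \<beta> k \<le> \<beta> (k + 1)"
    and \<alpha>_le: "\<And>k. k \<ge> k0 \<Longrightarrow> \<alpha> k \<le> 1 / real (max k (m k))"
    and \<beta>_bounds: "\<And>k. k \<ge> k0 \<Longrightarrow> 1 \<le> \<beta> k \<and> \<beta> k \<le> real k"
    and divergent: "\<not> (\<lambda>k. real (m k) * \<alpha> k) summable_on {k0..}"
    and convergent: "(\<lambda>k. real (m k) * \<alpha> k / \<beta> k) summable_on {k0..}"
    and less_half: "(\<Sum>\<^sub>\<infinity>k\<in>{k0..}. real (m k) * \<alpha> k / \<beta> k) < 1 / 2"
    and a: "\<And>k. k \<ge> k0 \<Longrightarrow> a k = \<alpha> k / \<beta> k"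
    and R: "\<And>k. k \<ge> k0 \<Longrightarrow> R k = 1 - (\<Sum>\<^sub>\<infinity>j\<in>{k..}. real (m j) * a j)"
    and X_finite: "\<And>k. k \<ge> k0 \<Longrightarrow> finite (X k)"
    and X_sub: "\<And>k. k \<ge> k0 \<Longrightarrow> X k \<subseteq> frontier (ball 0 (R k))"
    and X_cover: "\<And>k. k \<ge> k0 \<Longrightarrow> frontier (ball 0 (R k)) \<subseteq> (\<Union>x\<in>X k. ball x (a k / 3))"
    and X_disjoint: "\<And>k. k \<ge> k0 \<Longrightarrow> disjoint_family_on (\<lambda>x. ball x (a k / 9)) (X k)"
    and \<rho>: "\<And>k. k \<ge> k0 \<Longrightarrow>
      \<rho> k = (if DIM('a) = 2 then exp (- inverse (\<alpha> k))
             else a k * \<alpha> k powr (1 / (real DIM('a) - 2)))"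
    and r: "\<And>k x. k \<ge> k0 \<Longrightarrow> x \<in> X k \<Longrightarrow> r x = \<rho> k"
    and k1: "k1 \<ge> k0" "\<And>k. k \<ge> k1 \<Longrightarrow> \<rho> k < a k / 100"
    and k2: "k2 \<ge> k1"
    and f_pos: "\<And>t. t \<in> {0<..1 / real (m k2) ^ (DIM('a) - 1)} \<Longrightarrow> 0 < f t"
    and f_mono: "mono_on {0<..1 / real (m k2) ^ (DIM('a) - 1)} f"
    and f_sum: "(\<lambda>k. \<beta> k * f (\<alpha> k ^ (DIM('a) - 1))) summable_on {k2..}"
begin

section \<open>Radii and gaps of the layers\<close>

lemma \<alpha>_bounds:
  assumes "k0 \<le> k"
  shows "0 < \<alpha> k" "\<alpha> k * real (m k) \<le> 1" "\<alpha> k \<le> 1" "1 \<le> real (m k)"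
proof -
  show 1: "0 < \<alpha> k" and 4: "1 \<le> real (m k)"
    using pos[OF assms] by auto
  have "\<alpha> k \<le> 1 / real (m k)"
    using \<alpha>_le[OF assms] 4 by (rule_tac order.trans) (auto intro!: divide_left_mono)
  then show 2: "\<alpha> k * real (m k) \<le> 1"
    using 4 by (simp add: pos_le_divide_eq)
  have "\<alpha> k * 1 \<le> \<alpha> k * real (m k)"
    using 1 4 by (intro mult_left_mono) auto
  then show "\<alpha> k \<le> 1"
    using 2 by linarith
qed

lemma a_bounds:
  assumes "k0 \<le> k"
  shows "0 < a k" "a k \<le> \<alpha> k" "a (Suc k) \<le> a k" "\<alpha> k = a k * \<beta> k"
proof -
  have \<beta>: "1 \<le> \<beta> k" "\<beta> k \<le> \<beta> (Suc k)"
    using \<beta>_bounds[OF assms] mono[OF assms] by auto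
  show "0 < a k" "\<alpha> k = a k * \<beta> k"
    using \<beta> \<alpha>_bounds[OF assms] by (auto simp: a[OF assms])
  show "a k \<le> \<alpha> k"
    using \<beta> \<alpha>_bounds[OF assms] by (simp add: a[OF assms] divide_le_eq)
  show "a (Suc k) \<le> a k"
    using \<beta> \<alpha>_bounds[OF assms] \<alpha>_bounds[of "Suc k"] mono[OF assms] assms
    by (simp add: a frac_le)
qed

lemma a_antimono:
  assumes "k0 \<le> j" "j \<le> k"
  shows "a k \<le> a j"
  using assms(2)
proof (induction rule: dec_induct)
  case (step n)
  then show ?case
    using a_bounds(3)[of n] assms(1) by simp
qed simp

lemma gap_summable: "(\<lambda>k. real (m k) * a k) summable_on {k0..}"
  using convergent by (rule summable_on_cong[THEN iffD1, rotated]) (simp add: a)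

lemma gap_pos: "k0 \<le> k \<Longrightarrow> 0 < real (m k) * a k"
  using a_bounds(1) \<alpha>_bounds(4)[of k] by simp

lemma gap_nonneg: "k0 \<le> k \<Longrightarrow> 0 \<le> real (m k) * a k"
  using gap_pos less_imp_le by blast

lemma gap_ge: "k0 \<le> k \<Longrightarrow> a k \<le> real (m k) * a k"
  using a_bounds(1)[of k] \<alpha>_bounds(4)[of k] by simp

lemma R_add:
  assumes "k0 \<le> j" "j \<le> k"
  shows "R k = R j + (\<Sum>i=j..<k. real (m i) * a i)"
proof -
  have "(\<lambda>k. real (m k) * a k) summable_on {j..}"
    using gap_summable by (rule summable_on_subset_banach) (use assms in auto)
  from infsum_atLeast_split[OF this assms(2)] show ?thesis
    using assms by (simp add: R)
qed

text \<open>The outer sphere of layer k, where its barrier vanishes, carries the centers of layer k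
  + 1; this is what chains the layers together.\<close>

lemma R_Suc: "k0 \<le> k \<Longrightarrow> R (Suc k) = R k + real (m k) * a k"
  using R_add[of k "Suc k"] by simp

lemma R_le_one:
  assumes "k0 \<le> k"
  shows "R k \<le> 1"
proof -
  have "0 \<le> (\<Sum>\<^sub>\<infinity>j\<in>{k..}. real (m j) * a j)"
    using assms gap_nonneg by (intro infsum_nonneg) auto
  then show ?thesis
    by (simp add: R[OF assms])
qed

text \<open>Already the first gap is at least \<open>a j\<close>, because \<open>m j\<close> is at
  least 1. Bubbles reach less than a / 100 from their sphere, so this separates the layers.\<close>

lemma R_less_Suc:
  assumes "k0 \<le> j" "j < k"
  shows "R j + a j \<le> R k"
proof -
  have "real (m j) * a j \<le> (\<Sum>i=j..<k. real (m i) * a i)"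
    using assms gap_pos by (intro member_le_sum) (auto intro: less_imp_le)
  then show ?thesis
    using R_add[of j k] gap_ge[of j] assms by simp
qed

lemma R_half:
  assumes "k0 \<le> k"
  shows "1 / 2 < R k"
proof -
  have "infsum (\<lambda>k. real (m k) * \<alpha> k / \<beta> k) {k0..} = infsum (\<lambda>k. real (m k) * a k) {k0..}"
    by (rule infsum_cong) (simp add: a)
  then have "1 / 2 < R k0"
    using less_half by (simp add: R)
  moreover have "R k0 \<le> R k"
  proof -
    have "0 \<le> (\<Sum>i=k0..<k. real (m i) * a i)"
      using gap_nonneg by (intro sum_nonneg) auto
    then show ?thesis
      using R_add[of k0 k] assms by simp
  qed
  ultimately show ?thesis by simp
qed

lemma R_add_a_le_one: "k0 \<le> k \<Longrightarrow> R k + a k \<le> 1"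
  using R_less_Suc[of k "Suc k"] R_le_one[of "Suc k"] by simp

lemma R_eventually_gt:
  assumes "s < 1" "k0 \<le> k"
  shows "\<exists>n\<ge>k. s < R n"
proof -
  have "(\<lambda>k. real (m k) * a k) summable_on {k..}"
    using gap_summable by (rule summable_on_subset_banach) (use assms in auto)
  then obtain n where "n \<ge> k" "(\<Sum>\<^sub>\<infinity>j\<in>{n..}. real (m j) * a j) < 1 - s"
    using summable_on_tail_small[of "\<lambda>k. real (m k) * a k" k "1 - s"] gap_nonneg assms by auto
  then show ?thesis
    using assms by (intro exI[of _ n]) (simp add: R)
qed

lemma \<rho>_pos: "k0 \<le> k \<Longrightarrow> 0 < \<rho> k"
  using a_bounds(1)[of k] \<alpha>_bounds(1)[of k] by (simp add: \<rho>)

lemma norm_center: "k0 \<le> k \<Longrightarrow> x \<in> X k \<Longrightarrow> norm x = R k"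
  using X_sub[of k] R_half[of k] by (auto simp: frontier_ball)

lemma layer:
  assumes "k1 \<le> k"
  shows "layer (X k) (a k) (\<alpha> k) (\<rho> k) (R k) (real (m k))"
proof
  have k: "k0 \<le> k"
    using assms k1 by simp
  have fr: "frontier (ball 0 (R k)) = sphere (0::'a) (R k)"
    using R_half[OF k] by (intro frontier_ball) simp
  show "X k \<subseteq> sphere 0 (R k)" "sphere 0 (R k) \<subseteq> (\<Union>x\<in>X k. ball x (a k / 3))"
    using X_sub[OF k] X_cover[OF k] fr by auto
  show le: "\<rho> k \<le> a k"
    using k1(2)[OF assms] a_bounds(1)[OF k] by simp
  show "\<alpha> k * (kern DIM('a) ((\<rho> k)\<^sup>2 / (a k)\<^sup>2) - kern DIM('a) 1) \<le> 5 / 4"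
    using dim \<alpha>_bounds[OF k] a_bounds(1,2)[OF k] le by (intro capacity_bound[OF _ _ _ _ _ \<rho>[OF k]]) auto
  show "R k + real (m k) * a k \<le> 1"
    using R_Suc[OF k] R_le_one[of "Suc k"] k by simp
qed (use assms k1 dim X_finite a_bounds R_half \<alpha>_bounds \<rho>_pos in auto)

section \<open>Position of the bubbles and the champagne property\<close>

lemma bubble_norm:
  assumes "k1 \<le> k" "x \<in> X k" "z \<in> cball x (r x)"
  shows "R k - a k / 100 < norm z" "norm z < R k + a k / 100"
proof -
  have k: "k0 \<le> k"
    using assms k1 by simp
  have "dist x z < a k / 100"
    using assms r[OF k assms(2)] k1(2)[OF assms(1)] by simp
  then show "R k - a k / 100 < norm z" "norm z < R k + a k / 100"
    using norm_triangle_ineq2[of x z] norm_triangle_ineq2[of z x] norm_center[OF k assms(2)]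
    by (auto simp: dist_norm norm_minus_commute)
qed

lemma bubble_norm_less_one:
  assumes "k1 \<le> k" "x \<in> X k" "z \<in> cball x (r x)"
  shows "norm z < 1"
proof -
  have k: "k0 \<le> k"
    using assms k1 by simp
  show ?thesis
    using bubble_norm[OF assms] R_add_a_le_one[OF k] a_bounds(1)[OF k] by linarith
qed

lemma bubbles_inside:
  assumes "k1 \<le> k'"
  shows "bubbles (\<Union>k\<in>{k'..}. X k) r \<subseteq> ball 0 1"
proof
  fix z assume "z \<in> bubbles (\<Union>k\<in>{k'..}. X k) r"
  then obtain k x where "k' \<le> k" "x \<in> X k" "z \<in> cball x (r x)"
    unfolding bubbles_def by blast
  then show "z \<in> ball 0 1"
    using bubble_norm_less_one[of k x z] assms by simp
qed

text \<open>Only finitely many layers meet a smaller concentric ball.\<close>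

lemma open_champagne:
  assumes k': "k1 \<le> k'"
  shows "open (ball 0 1 - bubbles (\<Union>k\<in>{k'..}. X k) r)"
proof (subst open_subopen, rule ballI)
  fix z assume z: "z \<in> ball 0 1 - bubbles (\<Union>k\<in>{k'..}. X k) r"
  have k0': "k0 \<le> k'"
    using k' k1 by simp
  obtain s where s: "norm z < s" "s < 1"
    using z dense[of "norm z" 1] by auto
  obtain n where n: "n \<ge> k'" "s < R n"
    using R_eventually_gt[OF s(2) k0'] by blast
  define T where "T = ball 0 s - (\<Union>k\<in>{k'..n}. \<Union>x\<in>X k. cball x (r x))"
  have "open T"
    unfolding T_def using X_finite k0' by (intro open_Diff closed_UN ballI) auto
  moreover have "z \<in> T"
    using z s by (auto simp: T_def bubbles_def)
  moreover have "T \<subseteq> ball 0 1 - bubbles (\<Union>k\<in>{k'..}. X k) r"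
  proof
    fix w assume w: "w \<in> T"
    have "w \<notin> cball x (r x)" if k: "k' \<le> k" and x: "x \<in> X k" for k x
    proof (cases "k \<le> n")
      case True
      then show ?thesis
        using w k x by (auto simp: T_def)
    next
      case False
      \<comment> \<open>The gap of at least \<open>a n\<close> absorbs the inward reach of the
        bubbles of layer k.\<close>
      have "R n + a n \<le> R k"
        using R_less_Suc[of n k] False n k0' by simp
      moreover have "a k \<le> a n"
        using a_antimono[of n k] False n k0' by simp
      moreover have "0 < a n"
        using a_bounds(1)[of n] n k0' by simp
      ultimately have "s < R k - a k / 100"
        using n(2) by linarith
      then show ?thesis
        using w bubble_norm(1)[of k x w] k x k' by (auto simp: T_def)
    qed
    then show "w \<in> ball 0 1 - bubbles (\<Union>k\<in>{k'..}. X k) r"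
      using w s by (auto simp: T_def bubbles_def)
  qed
  ultimately show "\<exists>T. open T \<and> z \<in> T \<and> T \<subseteq> ball 0 1 - bubbles (\<Union>k\<in>{k'..}. X k) r"
    by blast
qed

text \<open>Bubbles of different layers occupy disjoint radial shells; within a layer they are
  disjoint because a / 100 is less than a / 9. A center of layer k has distance at least
  \<open>a k\<close> from the unit sphere, which bounds the quotients by 1 / 100, and the centers
  accumulate only at that sphere.\<close>

lemma champagne:
  assumes k': "k1 \<le> k'"
  shows "champagne_subregion (ball 0 1) (ball 0 1 - bubbles (\<Union>k\<in>{k'..}. X k) r) (\<Union>k\<in>{k'..}. X k) r"
proof -
  let ?X = "\<Union>k\<in>{k'..}. X k"
  have k0': "k0 \<le> k'"
    using k' k1 by simp
  have layer_eq: "j = k" if "j \<ge> k'" "k \<ge> k'" "x \<in> X j" "y \<in> X k" "z \<in> cball x (r x)" "z \<in> cball y (r y)"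
    for j k x y z
  proof -
    have less: False if "k' \<le> j" "j < k" "x \<in> X j" "y \<in> X k" "z \<in> cball x (r x)" "z \<in> cball y (r y)"
      for j k x y
    proof -
      have "R j + a j \<le> R k" "a k \<le> a j" "0 < a j"
        using R_less_Suc[of j k] a_antimono[of j k] a_bounds(1)[of j] that k0' by auto
      then show False
        using bubble_norm[of j x z] bubble_norm[of k y z] that k' by auto
    qed
    show ?thesis
      using less[of j k x y] less[of k j y x] that by (cases j k rule: linorder_cases) auto
  qed
  have r_bounds: "0 < r x" "r x < a k / 100" if "k' \<le> k" "x \<in> X k" for k x
    using r[of k x] \<rho>_pos[of k] k1(2)[of k] that k0' k' by auto
  have sub: "?X \<subseteq> ball 0 1"
  proof
    fix x assume "x \<in> ?X"
    then obtain k where k: "k' \<le> k" "x \<in> X k" by auto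
    then show "x \<in> ball 0 1"
      using bubble_norm_less_one[of k x x] r_bounds[OF k] k' by auto
  qed
  have limpt: "\<not> z islimpt ?X" if z: "z \<in> ball 0 1" for z
  proof -
    obtain s where s: "norm z < s" "s < 1"
      using z dense[of "norm z" 1] by auto
    obtain n where n: "n \<ge> k'" "s < R n"
      using R_eventually_gt[OF s(2) k0'] by blast
    have "?X \<inter> ball 0 s \<subseteq> (\<Union>k\<in>{k'..n}. X k)"
    proof
      fix x assume x: "x \<in> ?X \<inter> ball 0 s"
      then obtain k where k: "k' \<le> k" "x \<in> X k" by auto
      have "R n \<le> R k" if "n < k"
        using R_less_Suc[of n k] a_bounds(1)[of n] that n k0' by simp
      then have "k \<le> n"
        using norm_center[of k x] k k0' x n by (auto simp: not_less[symmetric])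
      then show "x \<in> (\<Union>k\<in>{k'..n}. X k)"
        using k by auto
    qed
    moreover have "finite (\<Union>k\<in>{k'..n}. X k)"
      using X_finite k0' by auto
    ultimately have "finite (ball 0 s \<inter> ?X)"
      by (metis finite_subset inf_commute)
    then have "\<not> z islimpt (ball 0 s \<inter> ?X)"
      by (rule islimpt_finite)
    moreover have "z \<in> ball 0 s"
      using s by simp
    ultimately show ?thesis
      by (metis islimpt_Int_eventually eventually_at_topological open_ball inf_commute)
  qed
  have disj: "disjoint_family_on (\<lambda>x. cball x (r x)) ?X"
    unfolding disjoint_family_on_def
  proof (intro ballI impI)
    fix x y assume xy: "x \<in> ?X" "y \<in> ?X" "x \<noteq> y"
    then obtain j k where jk: "k' \<le> j" "k' \<le> k" "x \<in> X j" "y \<in> X k" by auto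
    show "cball x (r x) \<inter> cball y (r y) = {}"
    proof (rule ccontr)
      assume "cball x (r x) \<inter> cball y (r y) \<noteq> {}"
      then obtain z where z: "z \<in> cball x (r x)" "z \<in> cball y (r y)" by auto
      have "j = k"
        using layer_eq[OF jk(1,2,3,4) z] .
      then have "z \<in> ball x (a k / 9)" "z \<in> ball y (a k / 9)"
        using z r_bounds[of k x] r_bounds[of k y] jk by auto
      moreover have "ball x (a k / 9) \<inter> ball y (a k / 9) = {}"
        using X_disjoint[of k] jk xy \<open>j = k\<close> k0' unfolding disjoint_family_on_def by auto
      ultimately show False by blast
    qed
  qed
  have "r x / infdist x (frontier (ball (0::'a) 1)) \<le> 1 / 100" if x: "x \<in> ?X" for x
  proof -
    obtain k where k: "k' \<le> k" "x \<in> X k"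
      using x by auto
    have "a k \<le> infdist x (sphere (0::'a) 1)"
    proof -
      have "a k \<le> (INF y\<in>sphere (0::'a) 1. dist x y)"
      proof (rule cINF_greatest)
        fix y :: 'a assume "y \<in> sphere 0 1"
        then show "a k \<le> dist x y"
          using R_add_a_le_one[of k] norm_center[of k x] k k0' norm_triangle_ineq2[of y x]
          by (simp add: dist_norm norm_minus_commute)
      qed simp
      then show ?thesis
        by (simp add: infdist_def)
    qed
    moreover have "0 < a k"
      using a_bounds(1)[of k] k k0' by simp
    ultimately have "r x / infdist x (sphere (0::'a) 1) \<le> (a k / 100) / a k"
      using r_bounds[OF k] by (intro frac_le) auto
    then show ?thesis
      using \<open>0 < a k\<close> by (simp add: frontier_ball)
  qed
  then have "(SUP x\<in>?X. ereal (r x / infdist x (frontier (ball (0::'a) 1)))) \<le> ereal (1 / 100)"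
    by (intro SUP_least) simp
  then have "(SUP x\<in>?X. ereal (r x / infdist x (frontier (ball (0::'a) 1)))) < 1"
    by (rule le_less_trans) simp
  moreover have "countable ?X"
    using X_finite k0' by (intro countable_UN) (auto intro: countable_finite)
  moreover have "0 < r x \<and> r x < 1" if x: "x \<in> ?X" for x
  proof -
    obtain k where k: "k' \<le> k" "x \<in> X k"
      using x by auto
    then show ?thesis
      using r_bounds[OF k] a_bounds(2)[of k] \<alpha>_bounds(3)[of k] k0' by auto
  qed
  ultimately show ?thesis
    unfolding champagne_subregion_def using sub limpt disj by auto
qed

text \<open>Starting from u \<ge> 0, that is from deficit 1, \<open>deficit_decrease\<close> is
  applied to consecutive layers from the outside inwards. The product of the factors tends to 0
  because the series of \<open>m k * \<alpha> k\<close> diverges.\<close>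

lemma perron_upper_ge_one:
  assumes k': "k1 \<le> k'" and A: "A = bubbles (\<Union>k\<in>{k'..}. X k) r" and V: "V = ball 0 1 - A"
    and u: "u \<in> perron_upper_class V (indicator A)" and y: "y \<in> V"
  shows "1 \<le> u y"
proof -
  let ?\<kappa> = "hit_const DIM('a)"
  have k0': "k0 \<le> k'"
    using k' k1 by simp
  have openV: "open V"
    unfolding V A by (rule open_champagne[OF k'])
  have sh: "superharmonic_on V u" and bdd: "bdd_below (u ` V)"
    and bdry: "\<And>\<zeta>. \<zeta> \<in> frontier V \<Longrightarrow> ereal (indicator A \<zeta>) \<le> Liminf (at \<zeta> within V) (\<lambda>z. ereal (u z))"
    using u unfolding perron_upper_class_def by auto
  have avoid: "\<rho> k \<le> infdist z (X k)" if "k' \<le> k" "z \<in> V" for k z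
  proof -
    interpret layer "X k" "a k" "\<alpha> k" "\<rho> k" "R k" "real (m k)"
      using that k' by (intro layer) simp
    obtain x where x: "x \<in> X k" "infdist z (X k) = dist z x"
      using infdist_attains_inf[OF finite_imp_closed[OF X_finite] X_nonempty] by blast
    have "z \<notin> cball x (r x)"
      using that x by (auto simp: V A bubbles_def)
    then show ?thesis
      using x r[of k x] that k0' by (simp add: dist_commute)
  qed
  have frontA: "1 \<le> Liminf (at \<zeta> within V) (\<lambda>z. ereal (u z))"
    if "\<zeta> \<in> frontier V" "norm \<zeta> < 1" for \<zeta>
  proof -
    have "\<zeta> \<in> A"
      using that openV by (auto simp: frontier_def interior_open V)
    then show ?thesis
      using bdry[OF that(1)] by (simp add: one_ereal_def)
  qed
  have clV: "norm \<zeta> \<le> 1" if "\<zeta> \<in> closure V" for \<zeta>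
  proof -
    have "closure V \<subseteq> cball 0 1"
      by (rule closure_minimal) (auto simp: V)
    then show ?thesis
      using that by auto
  qed
  \<comment> \<open>The boundary data are nonnegative; the comparison function is a strictly
    subharmonic perturbation of 0, nonpositive on the closed unit ball.\<close>
  have nonneg: "0 \<le> u z" if z: "z \<in> V" for z
  proof (rule field_le_epsilon)
    fix \<epsilon> :: real assume \<epsilon>: "\<epsilon> > 0"
    have "\<epsilon> * ((norm z)\<^sup>2 - 1) \<le> u z"
    proof (rule superharmonic_on_comparison[OF sh bdd openV _ _ _ _ z])
      show "bounded V"
        by (rule bounded_subset[of "ball 0 1"]) (auto simp: V)
      show "\<exists>\<Lambda>>0. laplacian_ge (\<lambda>z. \<epsilon> * ((norm z)\<^sup>2 - 1)) w \<Lambda>" for w :: 'a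
      proof (intro exI conjI)
        have "laplacian_ge (\<lambda>z. (norm (z - 0))\<^sup>2 - 1) w (2 * real DIM('a) * 1 + 4 * (norm (w - 0))\<^sup>2 * 0)"
          by (rule laplacian_ge_radial[where F = "\<lambda>t. t - 1" and F' = "\<lambda>t. 1" and F'' = 0])
             (auto intro!: derivative_eq_intros always_eventually)
        then show "laplacian_ge (\<lambda>z. \<epsilon> * ((norm z)\<^sup>2 - 1)) w (\<epsilon> * (2 * real DIM('a)))"
          using \<epsilon> by (intro laplacian_ge_cmult) auto
        show "0 < \<epsilon> * (2 * real DIM('a))"
          using \<epsilon> by simp
      qed
      show "ereal (\<epsilon> * ((norm \<zeta>)\<^sup>2 - 1)) \<le> Liminf (at \<zeta> within V) (\<lambda>z. ereal (u z))"
        if "\<zeta> \<in> frontier V" for \<zeta>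
      proof -
        have "(norm \<zeta>)\<^sup>2 \<le> 1"
          using that clV by (intro power_le_one) (auto simp: frontier_def)
        then have "\<epsilon> * ((norm \<zeta>)\<^sup>2 - 1) \<le> indicator A \<zeta>"
          using \<epsilon> by (simp add: mult_nonneg_nonpos order.trans[of _ 0])
        then show ?thesis
          using bdry[OF that] by (meson ereal_less_eq(3) order.trans)
      qed
    qed (intro continuous_intros)
    moreover have "- \<epsilon> \<le> \<epsilon> * ((norm z)\<^sup>2 - 1)"
      using \<epsilon> by (simp add: algebra_simps)
    ultimately show "0 \<le> u z + \<epsilon>" by simp
  qed
  define factor where "factor = (\<lambda>k. 1 - ?\<kappa> * \<alpha> k * real (m k))"
  have factor: "0 \<le> factor k" "factor k \<le> exp (- (?\<kappa> * (real (m k) * \<alpha> k)))" if "k0 \<le> k" for k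
  proof -
    have "?\<kappa> * (\<alpha> k * real (m k)) \<le> 1 * 1"
      using hit_const_pos[of "DIM('a)"] hit_const_le_one[of "DIM('a)"] \<alpha>_bounds[OF that] dim
      by (intro mult_mono) auto
    then show "0 \<le> factor k"
      by (simp add: factor_def mult.assoc)
    show "factor k \<le> exp (- (?\<kappa> * (real (m k) * \<alpha> k)))"
      using exp_ge_add_one_self[of "- (?\<kappa> * (real (m k) * \<alpha> k))"] by (simp add: factor_def ac_simps)
  qed
  \<comment> \<open>Here \<open>n\<close> counts the layers used, beginning with k. The induction
    hypothesis is taken at k + 1 and supplies the bound on the ball of radius
    \<open>R (Suc k)\<close>; n = 0 is the empty product.\<close>
  have main: "1 - (\<Prod>j=k..<k + n. factor j) \<le> u z" if "k' \<le> k" "z \<in> V" "norm z \<le> R k" for k n z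
    using that
  proof (induction n arbitrary: k z)
    case 0
    then show ?case
      using nonneg by simp
  next
    case (Suc n)
    interpret layer "X k" "a k" "\<alpha> k" "\<rho> k" "R k" "real (m k)"
      using Suc.prems k' by (intro layer) simp
    have RS: "R (Suc k) = R k + real (m k) * a k"
      using Suc.prems k0' by (intro R_Suc) simp
    define M where "M = (\<Prod>j=Suc k..<Suc k + n. factor j)"
    have "1 - M * (1 - ?\<kappa> * \<alpha> k * real (m k)) \<le> u z"
    proof (rule deficit_decrease[OF openV _ sh bdd])
      show "\<rho> k \<le> infdist z (X k)" if "z \<in> V" for z
        using avoid that Suc.prems by blast
      show "1 \<le> Liminf (at \<zeta> within V) (\<lambda>z. ereal (u z))"
        if "\<zeta> \<in> frontier V" "norm \<zeta> < R k + real (m k) * a k" for \<zeta>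
        using that outer_le by (intro frontA) auto
      show "0 \<le> M"
        unfolding M_def using factor(1) Suc.prems k0' by (intro prod_nonneg) auto
      show "1 - M \<le> u z" if "z \<in> V" "norm z < R k + real (m k) * a k" for z
        unfolding M_def using that Suc.prems RS by (intro Suc.IH) auto
    qed (use Suc.prems in auto)
    moreover have "(\<Prod>j=k..<k + Suc n. factor j) = M * (1 - ?\<kappa> * \<alpha> k * real (m k))"
      unfolding M_def by (subst prod.atLeast_Suc_lessThan) (auto simp: factor_def)
    ultimately show ?case by simp
  qed
  have "norm y < 1"
    using y by (simp add: V)
  then obtain k where k: "k' \<le> k" "norm y < R k"
    using R_eventually_gt k0' by blast
  show ?thesis
  proof (rule field_le_epsilon)
    fix \<epsilon> :: real assume \<epsilon>: "\<epsilon> > 0"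
    \<comment> \<open>So many layers that the exponential bound on the product of factors drops to
      \<open>\<epsilon>\<close>.\<close>
    obtain n where n: "- ln \<epsilon> / ?\<kappa> < (\<Sum>j=k..<k + n. real (m j) * \<alpha> j)"
    proof (rule exE[OF not_summable_on_unbounded[OF divergent, of k]])
      show "0 \<le> real (m j) * \<alpha> j" if "k0 \<le> j" for j
        using \<alpha>_bounds(1)[OF that] by simp
    qed (use k k0' in auto)
    have "(\<Prod>j=k..<k + n. factor j) \<le> (\<Prod>j=k..<k + n. exp (- (?\<kappa> * (real (m j) * \<alpha> j))))"
      using factor k k0' by (intro prod_mono) auto
    also have "\<dots> = exp (- (?\<kappa> * (\<Sum>j=k..<k + n. real (m j) * \<alpha> j)))"
      by (simp add: exp_sum sum_distrib_left sum_negf flip: exp_sum)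
    also have "\<dots> \<le> exp (ln \<epsilon>)"
    proof -
      have "- ln \<epsilon> < (\<Sum>j=k..<k + n. real (m j) * \<alpha> j) * ?\<kappa>"
        using n hit_const_pos[of "DIM('a)"] by (simp only: pos_divide_less_eq)
      then show ?thesis
        by (simp add: mult.commute[of ?\<kappa>])
    qed
    finally have "(\<Prod>j=k..<k + n. factor j) \<le> \<epsilon>"
      using \<epsilon> by simp
    then show "1 \<le> u y + \<epsilon>"
      using main[of k y n] k y by simp
  qed
qed

text \<open>The constant 1 belongs to the upper class, and every member of the class is at least
  1.\<close>

lemma unavoidable_bubbles:
  assumes k': "k1 \<le> k'"
  shows "unavoidable (ball 0 1) (bubbles (\<Union>k\<in>{k'..}. X k) r)"
proof -
  define A where "A = bubbles (\<Union>k\<in>{k'..}. X k) r"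
  define V where "V = ball 0 1 - A"
  have A: "A \<subseteq> ball 0 1"
    unfolding A_def by (rule bubbles_inside[OF k'])
  have "open V"
    unfolding V_def A_def by (rule open_champagne[OF k'])
  then have "closed (- V)"
    by auto
  moreover have "A = ball 0 1 \<inter> - V"
    using A by (auto simp: V_def)
  ultimately have "closedin (top_of_set (ball 0 1)) A"
    by (metis closedin_closed_Int)
  moreover have "perron_solution V (indicator A) y = 1" if y: "y \<in> V" for y
  proof (rule antisym)
    have "\<forall>\<^sub>F z in at_infinity. z \<notin> V"
      unfolding eventually_at_infinity by (rule exI[of _ 1]) (auto simp: V_def)
    then have "\<forall>\<^sub>F z in inf at_infinity (principal V). (0::ereal) \<le> ereal 1"
      by simp
    then have "(\<lambda>z. 1) \<in> perron_upper_class V (indicator A)"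
      unfolding perron_upper_class_def
      by (auto simp: superharmonic_on_const indicator_def intro!: Liminf_bounded)
    then show "perron_solution V (indicator A) y \<le> 1"
      unfolding perron_solution_def by (rule INF_lower2) simp
    show "1 \<le> perron_solution V (indicator A) y"
      unfolding perron_solution_def
      using perron_upper_ge_one[OF k' A_def V_def _ y] by (intro INF_greatest) (simp add: one_ereal_def)
  qed
  ultimately show ?thesis
    unfolding unavoidable_def harmonic_measure_def V_def A_def by blast
qed

section \<open>Summation over the centers\<close>

lemma phi_radius:
  assumes "k1 \<le> k" "x \<in> X k"
  shows "phi DIM('a) (r x) = a k ^ (DIM('a) - 2) * \<alpha> k"
proof -
  have k: "k0 \<le> k"
    using assms k1 by simp
  \<comment> \<open>For d = 2 the power of \<open>a k\<close> is 1 and \<open>phi\<close> inverts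
    the exponential; for d \<ge> 3 the power d - 2 undoes the exponent 1 / (d - 2).\<close>
  show ?thesis
  proof (cases "DIM('a) = 2")
    case True
    then show ?thesis
      using \<alpha>_bounds(1)[OF k] by (simp add: phi_def r[OF k assms(2)] \<rho>[OF k] exp_minus ln_inverse divide_inverse)
  next
    case False
    then have d: "0 < real DIM('a) - 2" "real (DIM('a) - 2) = real DIM('a) - 2"
      using dim by auto
    have "(\<alpha> k powr (1 / (real DIM('a) - 2))) ^ (DIM('a) - 2) = \<alpha> k"
      using d \<alpha>_bounds(1)[OF k] by (simp add: powr_realpow[symmetric] powr_powr)
    then show ?thesis
      using False by (simp add: phi_def r[OF k assms(2)] \<rho>[OF k] power_mult_distrib)
  qed
qed

lemma m_mono:
  assumes "k2 \<le> k"
  shows "m k2 \<le> m k"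
  using assms
proof (induction rule: dec_induct)
  case (step n)
  then show ?case
    using mono[of n] k1 k2 by simp
qed simp

text \<open>The number of centers is of order \<open>a k\<close> to the power 1 - d, and each
  contributes \<open>a k\<close> to the power d - 2 times
  \<open>\<alpha> k = a k * \<beta> k\<close>; the powers of \<open>a k\<close> cancel and
  \<open>\<beta> k\<close> is left. The argument of f is enlarged using
  \<open>a k \<le> \<alpha> k\<close>.\<close>

lemma layer_sum_le:
  assumes k: "k2 \<le> k"
  shows "(\<Sum>x\<in>X k. phi DIM('a) (r x) * f (phi DIM('a) (r x)))
    \<le> 2 * real DIM('a) * 9 ^ (DIM('a) - 1) * (\<beta> k * f (\<alpha> k ^ (DIM('a) - 1)))"
    and "x \<in> X k \<Longrightarrow> 0 \<le> phi DIM('a) (r x) * f (phi DIM('a) (r x))"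
    and "0 \<le> \<beta> k * f (\<alpha> k ^ (DIM('a) - 1))"
proof -
  let ?d = "DIM('a)"
  have k0: "k0 \<le> k" and k1k: "k1 \<le> k"
    using k k1 k2 by auto
  note \<alpha> = \<alpha>_bounds[OF k0] and a = a_bounds[OF k0]
  define t where "t = a k ^ (?d - 2) * \<alpha> k"
  have dS: "?d - 1 = Suc (?d - 2)"
    using dim by simp
  \<comment> \<open>Both arguments lie in the interval where f is known to be positive and
    increasing, since \<open>\<alpha> k \<le> 1 / m k\<close> and m increases.\<close>
  have t: "0 < t" "t \<le> \<alpha> k ^ (?d - 1)" "\<alpha> k ^ (?d - 1) \<le> 1 / real (m k2) ^ (?d - 1)"
  proof -
    show "0 < t"
      using a \<alpha> by (simp add: t_def)
    have "t \<le> \<alpha> k ^ (?d - 2) * \<alpha> k"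
      unfolding t_def using a \<alpha> by (intro mult_right_mono power_mono) auto
    then show "t \<le> \<alpha> k ^ (?d - 1)"
      by (simp only: dS power_Suc2)
    have m2: "0 < real (m k2)"
      using pos[of k2] k1 k2 by simp
    have "\<alpha> k \<le> 1 / real (m k)"
      using \<alpha> by (simp add: pos_le_divide_eq)
    also have "\<dots> \<le> 1 / real (m k2)"
      using m_mono[OF k] m2 by (intro divide_left_mono) auto
    finally have "\<alpha> k ^ (?d - 1) \<le> (1 / real (m k2)) ^ (?d - 1)"
      using \<alpha> by (intro power_mono) auto
    then show "\<alpha> k ^ (?d - 1) \<le> 1 / real (m k2) ^ (?d - 1)"
      by (simp add: power_divide)
  qed
  have ft: "0 < f t"
    using t by (intro f_pos) auto
  have fle: "f t \<le> f (\<alpha> k ^ (?d - 1))"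
    using t by (intro mono_onD[OF f_mono]) auto
  show "0 \<le> phi ?d (r x) * f (phi ?d (r x))" if "x \<in> X k" for x
    using t ft unfolding phi_radius[OF k1k that] t_def by simp
  have \<beta>: "0 \<le> \<beta> k"
    using \<beta>_bounds[OF k0] by simp
  then show "0 \<le> \<beta> k * f (\<alpha> k ^ (?d - 1))"
    using ft fle by simp
  have "real (card (X k)) * (a k / 9) ^ (?d - 1) \<le> 2 * ?d"
  proof (rule card_separated_sphere_le)
    show "X k \<subseteq> sphere 0 (R k)"
      using norm_center[OF k0] by auto
    show "a k / 9 \<le> R k" "R k + a k / 9 \<le> 1"
      using R_add_a_le_one[OF k0] R_half[OF k0] a by auto
  qed (use a X_finite[OF k0] X_disjoint[OF k0] in auto)
  then have card: "real (card (X k)) * a k ^ (?d - 1) \<le> 2 * real ?d * 9 ^ (?d - 1)"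
    by (simp add: power_divide pos_divide_le_eq)
  have "(\<Sum>x\<in>X k. phi ?d (r x) * f (phi ?d (r x))) = (\<Sum>x\<in>X k. t * f t)"
    using phi_radius[OF k1k] by (intro sum.cong) (auto simp: t_def)
  also have "\<dots> = (real (card (X k)) * a k ^ (?d - 1)) * (\<beta> k * f t)"
  proof -
    have "a k ^ (?d - 1) = a k ^ (?d - 2) * a k"
      by (simp only: dS power_Suc2)
    then show ?thesis
      using a(4) by (simp add: t_def)
  qed
  also have "\<dots> \<le> (2 * real ?d * 9 ^ (?d - 1)) * (\<beta> k * f t)"
    using card \<beta> ft by (intro mult_right_mono) auto
  also have "\<dots> \<le> (2 * real ?d * 9 ^ (?d - 1)) * (\<beta> k * f (\<alpha> k ^ (?d - 1)))"
    using fle \<beta> by (intro mult_left_mono) auto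
  finally show "(\<Sum>x\<in>X k. phi ?d (r x) * f (phi ?d (r x)))
    \<le> 2 * real ?d * 9 ^ (?d - 1) * (\<beta> k * f (\<alpha> k ^ (?d - 1)))" .
qed

text \<open>All terms are nonnegative, so it suffices to bound finite partial sums uniformly; this
  gives summability and the estimate together.\<close>

lemma bubble_sum:
  assumes k': "k2 \<le> k'"
  defines "g \<equiv> \<lambda>x. phi DIM('a) (r x) * f (phi DIM('a) (r x))"
  shows "g summable_on (\<Union>k\<in>{k'..}. X k)"
    and "infsum g (\<Union>k\<in>{k'..}. X k) \<le>
      2 * real DIM('a) * 9 ^ (DIM('a) - 1) * (\<Sum>\<^sub>\<infinity>k\<in>{k'..}. \<beta> k * f (\<alpha> k ^ (DIM('a) - 1)))"
proof -
  let ?X = "\<Union>k\<in>{k'..}. X k" and ?C = "2 * real DIM('a) * 9 ^ (DIM('a) - 1)"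
    and ?h = "\<lambda>k. \<beta> k * f (\<alpha> k ^ (DIM('a) - 1))"
  have k0': "k0 \<le> k'"
    using k' k1 k2 by simp
  have nonneg: "0 \<le> g x" if x: "x \<in> ?X" for x
  proof -
    obtain k where "k' \<le> k" "x \<in> X k"
      using x by auto
    then show ?thesis
      using layer_sum_le(2)[of k x] k' unfolding g_def by simp
  qed
  have hsum: "?h summable_on {k'..}"
    using f_sum by (rule summable_on_subset_banach) (use k' in auto)
  have disj: "X i \<inter> X j = {}" if "k' \<le> i" "k' \<le> j" "i \<noteq> j" for i j
  proof -
    have "R i \<noteq> R j"
      using that R_less_Suc[of i j] R_less_Suc[of j i] a_bounds(1)[of i] a_bounds(1)[of j] k0'
      by (cases i j rule: linorder_cases) auto
    then show ?thesis
      using norm_center[of i] norm_center[of j] that k0' by fastforce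
  qed
  have fin: "sum g F \<le> ?C * infsum ?h {k'..}" if F: "finite F" "F \<subseteq> ?X" for F
  proof -
    \<comment> \<open>A finite set of centers is enlarged to a union of finitely many whole layers,
      which are disjoint, so that the layer bounds add up.\<close>
    have "\<forall>x\<in>F. \<exists>k. k' \<le> k \<and> x \<in> X k"
      using F by auto
    then obtain \<kappa> where \<kappa>: "\<And>x. x \<in> F \<Longrightarrow> k' \<le> \<kappa> x \<and> x \<in> X (\<kappa> x)"
      by metis
    define K where "K = \<kappa> ` F"
    have K: "finite K" "K \<subseteq> {k'..}" "F \<subseteq> (\<Union>k\<in>K. X k)"
      using F \<kappa> by (auto simp: K_def)
    have "sum g F \<le> sum g (\<Union>k\<in>K. X k)"
    proof (rule sum_mono2)
      fix x assume "x \<in> (\<Union>k\<in>K. X k) - F"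
      then show "0 \<le> g x"
        using K by (intro nonneg) auto
    qed (use K X_finite k0' in auto)
    also have "\<dots> = (\<Sum>k\<in>K. sum g (X k))"
    proof (rule sum.UNION_disjoint)
      show "\<forall>i\<in>K. \<forall>j\<in>K. i \<noteq> j \<longrightarrow> X i \<inter> X j = {}"
        using K disj by (simp add: subset_iff)
    qed (use K X_finite k0' in auto)
    also have "\<dots> \<le> (\<Sum>k\<in>K. ?C * ?h k)"
      using K k' layer_sum_le(1) unfolding g_def by (intro sum_mono) auto
    also have "\<dots> = ?C * sum ?h K"
      by (simp add: sum_distrib_left)
    also have "\<dots> \<le> ?C * infsum ?h {k'..}"
      using K k' layer_sum_le(3) hsum by (intro mult_left_mono finite_sum_le_infsum) auto
    finally show ?thesis .
  qed
  show "g summable_on ?X"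
    using fin nonneg by (intro nonneg_bdd_above_summable_on) (auto intro!: bdd_aboveI2)
  then show "infsum g ?X \<le> ?C * infsum ?h {k'..}"
    using fin by (intro infsum_le_finite_sums) auto
qed

end

theorem theorem5p2:
  fixes k0 k1 k2 :: nat
    and m :: "nat \<Rightarrow> nat"
    and \<alpha> \<beta> a R \<rho> :: "nat \<Rightarrow> real"
    and X :: "nat \<Rightarrow> 'a::euclidean_space set"
    and r :: "'a \<Rightarrow> real"
    and f :: "real \<Rightarrow> real"
    and \<delta> :: real
  assumes dim: "DIM('a) \<ge> 2"
    and pos: "\<And>k. k \<ge> k0 \<Longrightarrow> 0 < m k \<and> 0 < \<alpha> k \<and> 0 < \<beta> k"
    and mono: "\<And>k. k \<ge> k0 \<Longrightarrow> m k \<le> m (k + 1) \<and> \<alpha> (k + 1) \<le> \<alpha> k \<and> \<beta> k \<le> \<beta> (k + 1)"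
    and \<alpha>_le: "\<And>k. k \<ge> k0 \<Longrightarrow> \<alpha> k \<le> 1 / real (max k (m k))"
    and \<beta>_bounds: "\<And>k. k \<ge> k0 \<Longrightarrow> 1 \<le> \<beta> k \<and> \<beta> k \<le> real k"
    and divergent: "\<not> (\<lambda>k. real (m k) * \<alpha> k) summable_on {k0..}"
    and convergent: "(\<lambda>k. real (m k) * \<alpha> k / \<beta> k) summable_on {k0..}"
    and less_half: "(\<Sum>\<^sub>\<infinity>k\<in>{k0..}. real (m k) * \<alpha> k / \<beta> k) < 1 / 2"
    and a: "\<And>k. k \<ge> k0 \<Longrightarrow> a k = \<alpha> k / \<beta> k"
    and R: "\<And>k. k \<ge> k0 \<Longrightarrow> R k = 1 - (\<Sum>\<^sub>\<infinity>j\<in>{k..}. real (m j) * a j)"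
    and X_finite: "\<And>k. k \<ge> k0 \<Longrightarrow> finite (X k)"
    and X_sub: "\<And>k. k \<ge> k0 \<Longrightarrow> X k \<subseteq> frontier (ball 0 (R k))"
    and X_cover: "\<And>k. k \<ge> k0 \<Longrightarrow> frontier (ball 0 (R k)) \<subseteq> (\<Union>x\<in>X k. ball x (a k / 3))"
    and X_disjoint: "\<And>k. k \<ge> k0 \<Longrightarrow> disjoint_family_on (\<lambda>x. ball x (a k / 9)) (X k)"
    and \<rho>: "\<And>k. k \<ge> k0 \<Longrightarrow>
      \<rho> k = (if DIM('a) = 2 then exp (- inverse (\<alpha> k))
             else a k * \<alpha> k powr (1 / (real DIM('a) - 2)))"
    and r: "\<And>k x. k \<ge> k0 \<Longrightarrow> x \<in> X k \<Longrightarrow> r x = \<rho> k"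
    and k1: "k1 \<ge> k0" "\<And>k. k \<ge> k1 \<Longrightarrow> \<rho> k < a k / 100"
    and k2: "k2 \<ge> k1"
    and f_pos: "\<And>t. t \<in> {0<..1 / real (m k2) ^ (DIM('a) - 1)} \<Longrightarrow> 0 < f t"
    and f_mono: "mono_on {0<..1 / real (m k2) ^ (DIM('a) - 1)} f"
    and f_sum: "(\<lambda>k. \<beta> k * f (\<alpha> k ^ (DIM('a) - 1))) summable_on {k2..}"
    and \<delta>: "\<delta> > 0"
  shows "\<exists>k'\<ge>k2.
    (let X\<^sub>A = (\<Union>k\<in>{k'..}. X k); A = bubbles X\<^sub>A r; U = ball 0 1 in
       unavoidable U A \<and>
       champagne_subregion U (U - A) X\<^sub>A r \<and>
       (\<lambda>x. phi DIM('a) (r x) * f (phi DIM('a) (r x))) summable_on X\<^sub>A \<and>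
       (\<Sum>\<^sub>\<infinity>x\<in>X\<^sub>A. phi DIM('a) (r x) * f (phi DIM('a) (r x))) < \<delta>)"
proof -
  interpret bubble_layers k0 k1 k2 m \<alpha> \<beta> a R \<rho> X r f
    by unfold_locales (fact assms)+
  define C where "C = 2 * real DIM('a) * 9 ^ (DIM('a) - 1)"
  have C: "C > 0"
    by (simp add: C_def)
  \<comment> \<open>The tail is made small enough to absorb the factor \<open>C\<close> from the
    count of centers.\<close>
  obtain k' where k': "k' \<ge> k2" "(\<Sum>\<^sub>\<infinity>k\<in>{k'..}. \<beta> k * f (\<alpha> k ^ (DIM('a) - 1))) < \<delta> / C"
    using summable_on_tail_small[OF f_sum, of "\<delta> / C"] layer_sum_le(3) \<delta> C by auto
  have "k1 \<le> k'"
    using k' k2 by simp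
  have "(\<Sum>\<^sub>\<infinity>x\<in>(\<Union>k\<in>{k'..}. X k). phi DIM('a) (r x) * f (phi DIM('a) (r x))) < \<delta>"
    using bubble_sum(2)[OF k'(1)] k'(2) C by (simp add: C_def field_simps)
  then show ?thesis
    using k'(1) unavoidable_bubbles[OF \<open>k1 \<le> k'\<close>] champagne[OF \<open>k1 \<le> k'\<close>] bubble_sum(1)[OF k'(1)]
    unfolding Let_def by blast
qed

end
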